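(* Fix $d\ge 1$, $\alpha\ge 0$, $c_0,r_0,C_0,\beta,L>0$, $\mu_{\max}>\mu_{\min}>0$, a compact set $\mathcal C\subset\mathbb R^d$ and a kernel $K$ satisfying conditions (K1)–(K4) of the context. Let $\mathcal P_\Sigma$ be the class of distributions and, for each $n\ge 1$, let $\hat\eta_n^*$ be the regression estimator with bandwidth $h=n^{-1/(2\beta+d)}$, both defined in the context. Let $C_1,C_2>0$ be constants depending only on $\beta,d,L,c_0,r_0,\mu_{\min},\mu_{\max},K$ such that for every $n\ge1$, every $\delta>0$, every $P\in\mathcal P_\Sigma$ and $P_X$-almost every $x$, $P^{\otimes n}(|\hat\eta_n^*(x)-\eta(x)|\ge\delta)\le C_1\exp(-C_2 n^{2\beta/(2\beta+d)}\delta^2)$ (such constants exist). Then there is a constant $C>0$ depending only on $\alpha$, $C_0$, $C_1$ and $C_2$ such that for any $n\ge 1$ the plug-in classifier $\hat f_n^*=\mathbf 1_{\{\hat\eta_n^*\ge 1/2\}}$ satisfies $$\sup_{P\in\mathcal P_\Sigma}\Big\{\mathbb E R(\hat f_n^* )-R(f^* )\Big\}\le C\, n^{-\frac{\beta(1+\alpha)}{2\beta+d}}.$$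
   Context: Setting. $(X,Y)$ is a random couple in $\mathcal Z=\mathbb R^d\times\{0,1\}$ with joint distribution $P$; $P_X$ is the marginal of $X$; $\eta(x)=P(Y=1|X=x)$ is the regression function (a function on $\mathbb R^d$ with values in $[0,1]$). The sample $(X_1,Y_1),\dots,(X_n,Y_n)$ consists of independent copies of $(X,Y)$, with law $P^{\otimes n}$. A decision rule is a Borel function $f:\mathbb R^d\to\{0,1\}$, with risk $R(f)=P(Y\ne f(X))$; $f^*(x)=\mathbf 1_{\{\eta(x)\ge1/2\}}$ is the Bayes rule. A classifier $\hat f_n$ is a decision rule depending measurably on the sample; $\mathbb E R(\hat f_n)$ is the expectation of $R(\hat f_n)$ over the sample. Margin assumption (MA) with constants $\alpha\ge0$, $C_0>0$: $P_X(0<|\eta(X)-1/2|\le t)\le C_0t^\alpha$ for all $t>0$. Hölder class. $\lfloor\beta\rfloor$ denotes the maximal integer strictly less than $\beta$. For a multi-index $s\in\mathbb N^d$, $|s|=\sum_i s_i$, $s!=\prod_i s_i!$, $x^s=\prod_i x_i^{s_i}$, $D^s$ is the corresponding partial derivative; $\|\cdot\|$ is the Euclidean norm. $\Sigma(\beta,L,\mathbb R^d)$ is the set of functions $g:\mathbb R^d\to\mathbb R$ that are $\lfloor\beta\rfloor$ times continuously differentiable with $|g(x')-g_x(x')|\le L\|x-x'\|^\beta$ for all $x,x'$, where $g_x(x')=\sum_{|s|\le\lfloor\beta\rfloor}\frac{(x'-x)^s}{s!}D^sg(x)$. Regular sets. A Lebesgue measurable $A\subset\mathbb R^d$ is $(c_0,r_0)$-regular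 if $\lambda[A\cap\mathcal B(x,r)]\ge c_0\lambda[\mathcal B(x,r)]$ for all $0<r\le r_0$ and $x\in A$, where $\lambda$ is Lebesgue measure and $\mathcal B(x,r)$ the closed Euclidean ball. Strong density assumption (with $c_0,r_0,\mu_{\min},\mu_{\max},\mathcal C$): $P_X$ is supported on a compact $(c_0,r_0)$-regular set $A\subseteq\mathcal C$ and has a density $\mu$ w.r.t. Lebesgue measure with $\mu_{\min}\le\mu(x)\le\mu_{\max}$ for $x\in A$ and $\mu(x)=0$ otherwise. Class $\mathcal P_\Sigma$: all probability distributions $P$ on $\mathcal Z$ such that (i) (MA) holds with $\alpha,C_0$; (ii) $\eta\in\Sigma(\beta,L,\mathbb R^d)$; (iii) the strong density assumption holds. Kernel conditions for $K:\mathbb R^d\to[0,\infty)$: (K1) there is $c>0$ with $K(x)\ge c\,\mathbf 1_{\{\|x\|\le c\}}$ for all $x$; (K2) $\int K(u)du=1$; (K3) $\int(1+\|u\|^{4\beta})K^2(u)du<\infty$; (K4) $\sup_u(1+\|u\|^{2\beta})K(u)<\infty$. Locally polynomial estimator of order $l$ with bandwidth $h>0$ and kernel $K$: let $\hat\theta_x$ be a polynomial on $\mathbb R^d$ of degree $l$ minimizing $\sum_{i=1}^n[Y_i-\hat\theta_x(X_i-x)]^2K(\frac{X_i-x}{h})$; $\hat\eta_n^{LP}(x)=\hat\theta_x(0)$ if the minimizer is unique and $\hat\eta_n^{LP}(x)=0$ otherwise. Estimator $\hat\eta_n^*$: let $\bar B=(\bar B_{s_1,s_2})_{|s_1|,|s_2|\le\lfloor\beta\rfloor}$,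 $\bar B_{s_1,s_2}=\frac1{nh^d}\sum_{i=1}^n(\frac{X_i-x}{h})^{s_1+s_2}K(\frac{X_i-x}{h})$. If the smallest eigenvalue of $\bar B$ is greater than $(\log n)^{-1}$, then $\hat\eta_n^*(x)$ is the projection onto $[0,1]$ of $\hat\eta_n^{LP}(x)$, the locally polynomial estimator of order $\lfloor\beta\rfloor$ with bandwidth $h$ and kernel $K$; otherwise $\hat\eta_n^*(x)=0$. For $n=1$, $(\log n)^{-1}$ is read as $+\infty$. *)

theory Defs
  imports "HOL-Probability.Probability"
begin

text \<open>
  The dimension \<open>d\<close> has to be quantified inside the theorem (the final constant may not depend
  on it), so the space \<open>\<real>\<^sup>d\<close> is modelled by the extensional functions on \<open>{..<d}\<close> rather than
  by a type, with the product of \<open>d\<close> copies of one-dimensional Lebesgue measure.  The product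
  topology of the type \<^typ>\<open>nat \<Rightarrow> real\<close> restricts to the Euclidean topology on this carrier, so
  \<^const>\<open>compact\<close> and \<^const>\<open>continuous_on\<close> have their usual meaning there.
\<close>

definition Rd :: "nat \<Rightarrow> (nat \<Rightarrow> real) set" where
  "Rd d = ({..<d} \<rightarrow>\<^sub>E UNIV)"

definition leb_Rd :: "nat \<Rightarrow> (nat \<Rightarrow> real) measure" where
  "leb_Rd d = PiM {..<d} (\<lambda>_. lborel)"

definition enorm :: "nat \<Rightarrow> (nat \<Rightarrow> real) \<Rightarrow> real" where
  "enorm d x = L2_set x {..<d}"

definition cball_Rd :: "nat \<Rightarrow> (nat \<Rightarrow> real) \<Rightarrow> real \<Rightarrow> (nat \<Rightarrow> real) set" where
  "cball_Rd d x r = {y \<in> Rd d. enorm d (\<lambda>i. y i - x i) \<le> r}"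


subsection \<open>Multi-indices and Hoelder classes\<close>

text \<open>A multi-index is a function on \<open>nat\<close> vanishing outside \<open>{..<d}\<close>.\<close>

definition multi_indices :: "nat \<Rightarrow> nat \<Rightarrow> (nat \<Rightarrow> nat) set" where
  "multi_indices d k = {s. (\<forall>i\<ge>d. s i = 0) \<and> (\<Sum>i<d. s i) \<le> k}"

definition mfact :: "nat \<Rightarrow> (nat \<Rightarrow> nat) \<Rightarrow> real" where
  "mfact d s = (\<Prod>i<d. fact (s i))"

definition mpow :: "nat \<Rightarrow> (nat \<Rightarrow> real) \<Rightarrow> (nat \<Rightarrow> nat) \<Rightarrow> real" where
  "mpow d x s = (\<Prod>i<d. x i ^ s i)"

text \<open>The largest integer strictly less than \<open>\<beta>\<close> (for \<open>\<beta> > 0\<close>); not the usual floor.\<close>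

definition strict_floor :: "real \<Rightarrow> nat" where
  "strict_floor \<beta> = nat (\<lceil>\<beta>\<rceil> - 1)"

definition partial_deriv :: "nat \<Rightarrow> ((nat \<Rightarrow> real) \<Rightarrow> real) \<Rightarrow> (nat \<Rightarrow> real) \<Rightarrow> real" where
  "partial_deriv i g x = deriv (\<lambda>t. g (x(i := t))) (x i)"

text \<open>The order of differentiation is immaterial for the functions to which this is applied.\<close>

definition multi_deriv ::
    "nat \<Rightarrow> (nat \<Rightarrow> nat) \<Rightarrow> ((nat \<Rightarrow> real) \<Rightarrow> real) \<Rightarrow> (nat \<Rightarrow> real) \<Rightarrow> real" where
  "multi_deriv d s g = foldr (\<lambda>i. partial_deriv i ^^ s i) [0..<d] g"

fun cont_diff :: "nat \<Rightarrow> nat \<Rightarrow> ((nat \<Rightarrow> real) \<Rightarrow> real) \<Rightarrow> bool" where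
  "cont_diff d 0 g \<longleftrightarrow> continuous_on (Rd d) g"
| "cont_diff d (Suc k) g \<longleftrightarrow> continuous_on (Rd d) g \<and>
     (\<forall>i<d. (\<forall>x\<in>Rd d. (\<lambda>t. g (x(i := t))) differentiable (at (x i))) \<and>
            cont_diff d k (partial_deriv i g))"

definition taylor_poly ::
    "nat \<Rightarrow> nat \<Rightarrow> ((nat \<Rightarrow> real) \<Rightarrow> real) \<Rightarrow> (nat \<Rightarrow> real) \<Rightarrow> (nat \<Rightarrow> real) \<Rightarrow> real" where
  "taylor_poly d k g x x' =
     (\<Sum>s\<in>multi_indices d k. mpow d (\<lambda>i. x' i - x i) s / mfact d s * multi_deriv d s g x)"

definition holder_class :: "nat \<Rightarrow> real \<Rightarrow> real \<Rightarrow> ((nat \<Rightarrow> real) \<Rightarrow> real) set" where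
  "holder_class d \<beta> L = {g. cont_diff d (strict_floor \<beta>) g \<and>
     (\<forall>x\<in>Rd d. \<forall>x'\<in>Rd d.
        \<bar>g x' - taylor_poly d (strict_floor \<beta>) g x x'\<bar>
          \<le> L * enorm d (\<lambda>i. x i - x' i) powr \<beta>)}"


subsection \<open>The classification model\<close>

text \<open>Labels \<open>1\<close> and \<open>0\<close> are \<^term>\<open>True\<close> and \<^term>\<open>False\<close>.\<close>

definition joint_distribution :: "nat \<Rightarrow> ((nat \<Rightarrow> real) \<times> bool) measure \<Rightarrow> bool" where
  "joint_distribution d P \<longleftrightarrow>
     prob_space P \<and> sets P = sets (leb_Rd d \<Otimes>\<^sub>M count_space (UNIV :: bool set))"

definition marginal :: "nat \<Rightarrow> ((nat \<Rightarrow> real) \<times> bool) measure \<Rightarrow> (nat \<Rightarrow> real) measure" where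
  "marginal d P = distr P (leb_Rd d) fst"

text \<open>
  \<open>\<eta>\<close> is a version of \<open>x \<mapsto> P(Y = 1 | X = x)\<close>; any two versions agree almost everywhere with
  respect to the marginal.
\<close>

definition regression_function ::
    "nat \<Rightarrow> ((nat \<Rightarrow> real) \<times> bool) measure \<Rightarrow> ((nat \<Rightarrow> real) \<Rightarrow> real) \<Rightarrow> bool" where
  "regression_function d P \<eta> \<longleftrightarrow>
     \<eta> \<in> borel_measurable (leb_Rd d) \<and>
     (\<forall>x\<in>Rd d. 0 \<le> \<eta> x \<and> \<eta> x \<le> 1) \<and>
     (\<forall>A\<in>sets (leb_Rd d). measure P (A \<times> {True}) = (LINT x:A|marginal d P. \<eta> x))"

definition risk ::
    "((nat \<Rightarrow> real) \<times> bool) measure \<Rightarrow> ((nat \<Rightarrow> real) \<Rightarrow> bool) \<Rightarrow> real" where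
  "risk P f = measure P {z \<in> space P. snd z \<noteq> f (fst z)}"

definition plug_in :: "((nat \<Rightarrow> real) \<Rightarrow> real) \<Rightarrow> (nat \<Rightarrow> real) \<Rightarrow> bool" where
  "plug_in g x \<longleftrightarrow> g x \<ge> 1/2"

definition sample_law ::
    "nat \<Rightarrow> ((nat \<Rightarrow> real) \<times> bool) measure \<Rightarrow> (nat \<Rightarrow> (nat \<Rightarrow> real) \<times> bool) measure" where
  "sample_law n P = PiM {..<n} (\<lambda>_. P)"

definition margin_assumption ::
    "nat \<Rightarrow> real \<Rightarrow> real \<Rightarrow> ((nat \<Rightarrow> real) \<times> bool) measure \<Rightarrow> ((nat \<Rightarrow> real) \<Rightarrow> real) \<Rightarrow> bool" where
  "margin_assumption d \<alpha> C0 P \<eta> \<longleftrightarrow>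
     (\<forall>t>0. measure (marginal d P) {x \<in> Rd d. 0 < \<bar>\<eta> x - 1/2\<bar> \<and> \<bar>\<eta> x - 1/2\<bar> \<le> t}
              \<le> C0 * t powr \<alpha>)"

text \<open>Regular sets are only required to be Lebesgue measurable, hence the completion.\<close>

definition regular_set :: "nat \<Rightarrow> real \<Rightarrow> real \<Rightarrow> (nat \<Rightarrow> real) set \<Rightarrow> bool" where
  "regular_set d c0 r0 A \<longleftrightarrow>
     A \<in> sets (completion (leb_Rd d)) \<and>
     (\<forall>r. 0 < r \<and> r \<le> r0 \<longrightarrow> (\<forall>x\<in>A.
        measure (completion (leb_Rd d)) (A \<inter> cball_Rd d x r)
          \<ge> c0 * measure (completion (leb_Rd d)) (cball_Rd d x r)))"

definition strong_density ::
    "nat \<Rightarrow> real \<Rightarrow> real \<Rightarrow> real \<Rightarrow> real \<Rightarrow> (nat \<Rightarrow> real) set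
      \<Rightarrow> ((nat \<Rightarrow> real) \<times> bool) measure \<Rightarrow> bool" where
  "strong_density d c0 r0 \<mu>min \<mu>max \<C> P \<longleftrightarrow>
     (\<exists>A \<mu>. compact A \<and> regular_set d c0 r0 A \<and> A \<subseteq> \<C> \<and>
        (AE x in marginal d P. x \<in> A) \<and>
        \<mu> \<in> borel_measurable (leb_Rd d) \<and>
        marginal d P = density (leb_Rd d) (\<lambda>x. ennreal (\<mu> x)) \<and>
        (\<forall>x\<in>A. \<mu>min \<le> \<mu> x \<and> \<mu> x \<le> \<mu>max) \<and>
        (\<forall>x\<in>Rd d - A. \<mu> x = 0))"

definition P_Sigma ::
    "nat \<Rightarrow> real \<Rightarrow> real \<Rightarrow> real \<Rightarrow> real \<Rightarrow> real \<Rightarrow> real \<Rightarrow> real \<Rightarrow> real \<Rightarrow> (nat \<Rightarrow> real) set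
      \<Rightarrow> ((nat \<Rightarrow> real) \<times> bool) measure set" where
  "P_Sigma d \<alpha> C0 \<beta> L c0 r0 \<mu>min \<mu>max \<C> =
     {P. joint_distribution d P \<and>
         (\<exists>\<eta>. regression_function d P \<eta> \<and> margin_assumption d \<alpha> C0 P \<eta> \<and>
              \<eta> \<in> holder_class d \<beta> L) \<and>
         strong_density d c0 r0 \<mu>min \<mu>max \<C> P}"


subsection \<open>The estimator\<close>

definition kernel_conditions :: "nat \<Rightarrow> real \<Rightarrow> ((nat \<Rightarrow> real) \<Rightarrow> real) \<Rightarrow> bool" where
  "kernel_conditions d \<beta> K \<longleftrightarrow>
     K \<in> borel_measurable (leb_Rd d) \<and> (\<forall>u\<in>Rd d. 0 \<le> K u) \<and>
     (\<exists>c>0. \<forall>x\<in>Rd d. K x \<ge> c * of_bool (enorm d x \<le> c)) \<and>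
     has_bochner_integral (leb_Rd d) K 1 \<and>
     integrable (leb_Rd d) (\<lambda>u. (1 + enorm d u powr (4 * \<beta>)) * (K u)\<^sup>2) \<and>
     bdd_above ((\<lambda>u. (1 + enorm d u powr (2 * \<beta>)) * K u) ` Rd d)"

text \<open>Rescaled and restricted so that the result lies in \<open>Rd d\<close>.\<close>

definition scaled_diff ::
    "nat \<Rightarrow> real \<Rightarrow> (nat \<Rightarrow> real) \<Rightarrow> (nat \<Rightarrow> real) \<Rightarrow> nat \<Rightarrow> real" where
  "scaled_diff d h x z = (\<lambda>j\<in>{..<d}. (z j - x j) / h)"

text \<open>
  Polynomials of degree at most \<open>l\<close> in \<open>d\<close> variables, as functions; they depend only on the
  coordinates below \<open>d\<close>, and over the reals a polynomial is determined by its function.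
\<close>

definition poly_funs :: "nat \<Rightarrow> nat \<Rightarrow> ((nat \<Rightarrow> real) \<Rightarrow> real) set" where
  "poly_funs d l = {p. \<exists>c. p = (\<lambda>u. \<Sum>s\<in>multi_indices d l. c s * mpow d u s)}"

definition lp_objective ::
    "nat \<Rightarrow> nat \<Rightarrow> real \<Rightarrow> ((nat \<Rightarrow> real) \<Rightarrow> real) \<Rightarrow> (nat \<Rightarrow> (nat \<Rightarrow> real) \<times> bool)
      \<Rightarrow> (nat \<Rightarrow> real) \<Rightarrow> ((nat \<Rightarrow> real) \<Rightarrow> real) \<Rightarrow> real" where
  "lp_objective d n h K \<omega> x p =
     (\<Sum>i<n. (of_bool (snd (\<omega> i)) - p (\<lambda>j. fst (\<omega> i) j - x j))\<^sup>2
               * K (scaled_diff d h x (fst (\<omega> i))))"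

definition lp_minimizer ::
    "nat \<Rightarrow> nat \<Rightarrow> nat \<Rightarrow> real \<Rightarrow> ((nat \<Rightarrow> real) \<Rightarrow> real) \<Rightarrow> (nat \<Rightarrow> (nat \<Rightarrow> real) \<times> bool)
      \<Rightarrow> (nat \<Rightarrow> real) \<Rightarrow> ((nat \<Rightarrow> real) \<Rightarrow> real) \<Rightarrow> bool" where
  "lp_minimizer d l n h K \<omega> x p \<longleftrightarrow>
     is_arg_min (lp_objective d n h K \<omega> x) (\<lambda>q. q \<in> poly_funs d l) p"

definition lp_estimator ::
    "nat \<Rightarrow> nat \<Rightarrow> nat \<Rightarrow> real \<Rightarrow> ((nat \<Rightarrow> real) \<Rightarrow> real) \<Rightarrow> (nat \<Rightarrow> (nat \<Rightarrow> real) \<times> bool)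
      \<Rightarrow> (nat \<Rightarrow> real) \<Rightarrow> real" where
  "lp_estimator d l n h K \<omega> x =
     (if \<exists>!p. lp_minimizer d l n h K \<omega> x p
      then (THE p. lp_minimizer d l n h K \<omega> x p) (\<lambda>_. 0) else 0)"

definition B_bar ::
    "nat \<Rightarrow> nat \<Rightarrow> real \<Rightarrow> ((nat \<Rightarrow> real) \<Rightarrow> real) \<Rightarrow> (nat \<Rightarrow> (nat \<Rightarrow> real) \<times> bool)
      \<Rightarrow> (nat \<Rightarrow> real) \<Rightarrow> (nat \<Rightarrow> nat) \<Rightarrow> (nat \<Rightarrow> nat) \<Rightarrow> real" where
  "B_bar d n h K \<omega> x s1 s2 =
     1 / (real n * h ^ d) *
     (\<Sum>i<n. mpow d (scaled_diff d h x (fst (\<omega> i))) (\<lambda>j. s1 j + s2 j)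
               * K (scaled_diff d h x (fst (\<omega> i))))"

text \<open>Matrices whose rows and columns are indexed by a finite set \<open>I\<close>.\<close>

definition eigenvalues_on :: "'i set \<Rightarrow> ('i \<Rightarrow> 'i \<Rightarrow> real) \<Rightarrow> real set" where
  "eigenvalues_on I M = {ev. \<exists>v. (\<exists>s\<in>I. v s \<noteq> 0) \<and>
     (\<forall>s\<in>I. (\<Sum>t\<in>I. M s t * v t) = ev * v s)}"

text \<open>For \<open>n = 1\<close> the threshold \<open>1 / ln n\<close> is read as \<open>\<infinity>\<close>, so the first branch needs \<open>n > 1\<close>.\<close>

definition eta_star ::
    "nat \<Rightarrow> real \<Rightarrow> nat \<Rightarrow> real \<Rightarrow> ((nat \<Rightarrow> real) \<Rightarrow> real) \<Rightarrow> (nat \<Rightarrow> (nat \<Rightarrow> real) \<times> bool)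
      \<Rightarrow> (nat \<Rightarrow> real) \<Rightarrow> real" where
  "eta_star d \<beta> n h K \<omega> x =
     (if n > 1 \<and> Min (eigenvalues_on (multi_indices d (strict_floor \<beta>)) (B_bar d n h K \<omega> x))
                   > 1 / ln (real n)
      then closest_point {0..1} (lp_estimator d (strict_floor \<beta>) n h K \<omega> x)
      else 0)"

definition bandwidth :: "nat \<Rightarrow> real \<Rightarrow> nat \<Rightarrow> real" where
  "bandwidth d \<beta> n = real n powr (- 1 / (2 * \<beta> + real d))"

end

theory Submission
  imports Defs "Jordan_Normal_Form.Char_Poly" "HOL-Real_Asymp.Real_Asymp"
begin

text \<open>
  By Fubini, the expected excess risk is the integral over \<open>x\<close> of \<open>\<bar>2 \<eta>(x) - 1\<bar>\<close> times the
  probability that the plug-in rule disagrees with the Bayes rule at \<open>x\<close>.  Disagreement forces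
  \<open>\<bar>\<eta>*(x) - \<eta>(x)\<bar> \<ge> \<bar>\<eta>(x) - 1/2\<bar>\<close>, so the exponential inequality bounds that probability.  Put
  \<open>a = n powr (2 \<beta> / (2 \<beta> + d))\<close> and \<open>\<delta> = a powr (-1/2)\<close> and cut the space into the slices
  \<open>2 ^ (j - 1) \<delta> < \<bar>\<eta>(x) - 1/2\<bar> \<le> 2 ^ j \<delta>\<close>.  By the margin assumption the \<open>j\<close>-th slice contributes at
  most a constant times \<open>\<delta> powr (1 + \<alpha>) * (2 ^ j) powr (1 + \<alpha>) * exp (- C2 * 4 ^ j / 4)\<close>, which is
  summable in \<open>j\<close>.  Only countably many thresholds occur, so the null sets in the exponential
  inequality, which depend on the threshold, do no harm.

  Fubini needs joint measurability of the estimator in the sample and \<open>x\<close>.  Where the smallest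
  eigenvalue exceeds the positive threshold, the normal equations are nonsingular and Cramer's
  rule expresses the estimator by determinants.  The eigenvalue condition is measurable because it
  asks for the absence of a zero of a characteristic polynomial on a half-line, which by compactness
  and density reduces to countably many conditions.
\<close>

subsection \<open>Measurability of the existence of a zero\<close>

text \<open>A zero exists iff the modulus of \<open>g x\<close> falls below every
  \<open>1 / Suc k\<close> on a countable dense subset of \<open>S\<close>. Continuity gives one
  direction; for the other, the minimum of the modulus is attained on the compact set and lies below
  every \<open>1 / Suc k\<close>.\<close>

lemma pred_ex_zero_compact:
  fixes g :: "'a \<Rightarrow> 'b::{metric_space, second_countable_topology} \<Rightarrow> real"
  assumes S: "compact S"
    and cont: "\<And>x. x \<in> space M \<Longrightarrow> continuous_on S (g x)"
    and meas [measurable]: "\<And>y. y \<in> S \<Longrightarrow> (\<lambda>x. g x y) \<in> borel_measurable M"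
  shows "Measurable.pred M (\<lambda>x. \<exists>y\<in>S. g x y = 0)"
proof -
  obtain T where T: "countable T" "T \<subseteq> S" "S \<subseteq> closure T"
    by (rule separable)
  have eq: "(\<exists>y\<in>S. g x y = 0) \<longleftrightarrow> (\<forall>k::nat. \<exists>y\<in>T. \<bar>g x y\<bar> < 1 / Suc k)" if x: "x \<in> space M" for x
  proof (intro iffI allI)
    fix k :: nat
    assume "\<exists>y\<in>S. g x y = 0"
    then obtain y where y: "y \<in> S" "g x y = 0" by blast
    obtain e where e: "e > 0" "\<And>y'. y' \<in> S \<Longrightarrow> dist y' y < e \<Longrightarrow> dist (g x y') (g x y) < 1 / Suc k"
      using cont[OF x, unfolded continuous_on_iff, rule_format, OF y(1), of "1 / Suc k"] by auto
    obtain y' where "y' \<in> T" "dist y' y < e"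
      using T(3) y(1) e(1) by (meson closure_approachable subsetD)
    then show "\<exists>y\<in>T. \<bar>g x y\<bar> < 1 / Suc k"
      using e(2)[of y'] T(2) y(2) by (auto simp: dist_real_def)
  next
    assume *: "\<forall>k::nat. \<exists>y\<in>T. \<bar>g x y\<bar> < 1 / Suc k"
    then have "S \<noteq> {}" using T(2) by blast
    have "continuous_on S (\<lambda>y. \<bar>g x y\<bar>)"
      using cont[OF x] by (intro continuous_intros)
    from continuous_attains_inf[OF S \<open>S \<noteq> {}\<close> this]
    obtain y where y: "y \<in> S" "\<And>z. z \<in> S \<Longrightarrow> \<bar>g x y\<bar> \<le> \<bar>g x z\<bar>" by blast
    have "g x y = 0"
    proof (rule ccontr)
      assume "g x y \<noteq> 0"
      then obtain k :: nat where "1 / Suc k < \<bar>g x y\<bar>"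
        using nat_approx_posE[of "\<bar>g x y\<bar>"] by auto
      moreover obtain z where "z \<in> T" "\<bar>g x z\<bar> < 1 / Suc k" using * by blast
      ultimately show False using y(2)[of z] T(2) by auto
    qed
    with y(1) show "\<exists>y\<in>S. g x y = 0" by blast
  qed
  have "Measurable.pred M (\<lambda>x. \<forall>k::nat. \<exists>y\<in>T. \<bar>g x y\<bar> < 1 / Suc k)"
  proof (intro pred_intros_countable(1), unfold pred_def, intro sets.sets_Collect_countable_Ex'[OF _ T(1)])
    fix k y assume "y \<in> T"
    then have [measurable]: "(\<lambda>x. g x y) \<in> borel_measurable M" using meas T(2) by blast
    show "{x \<in> space M. \<bar>g x y\<bar> < 1 / Suc k} \<in> sets M" by measurable
  qed
  then show ?thesis by (subst measurable_cong[OF eq]) auto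
qed

text \<open>The half-line is not compact, but it is a countable union of the compact intervals
  \<open>{c - real N..c}\<close>.\<close>

lemma pred_ex_zero_le:
  fixes g :: "'a \<Rightarrow> real \<Rightarrow> real"
  assumes cont: "\<And>x. x \<in> space M \<Longrightarrow> continuous_on UNIV (g x)"
    and meas: "\<And>y. (\<lambda>x. g x y) \<in> borel_measurable M"
  shows "Measurable.pred M (\<lambda>x. \<exists>y\<le>c. g x y = 0)"
proof -
  have "(\<exists>y\<le>c. g x y = 0) \<longleftrightarrow> (\<exists>N::nat. \<exists>y\<in>{c - real N..c}. g x y = 0)" for x
  proof
    assume "\<exists>y\<le>c. g x y = 0"
    then obtain y where y: "y \<le> c" "g x y = 0" by blast
    obtain N :: nat where "c - y \<le> N" using real_arch_simple by blast
    with y show "\<exists>N::nat. \<exists>y\<in>{c - real N..c}. g x y = 0"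
      by (intro exI[of _ N] bexI[of _ y]) auto
  qed auto
  moreover have "Measurable.pred M (\<lambda>x. \<exists>N::nat. \<exists>y\<in>{c - real N..c}. g x y = 0)"
    using continuous_on_subset[OF cont] meas
    by (intro pred_intros_countable(2) pred_ex_zero_compact) auto
  ultimately show ?thesis by simp
qed

lemma pred_ex_zero:
  fixes g :: "'a \<Rightarrow> real \<Rightarrow> real"
  assumes cont: "\<And>x. x \<in> space M \<Longrightarrow> continuous_on UNIV (g x)"
    and meas: "\<And>y. (\<lambda>x. g x y) \<in> borel_measurable M"
  shows "Measurable.pred M (\<lambda>x. \<exists>y. g x y = 0)"
proof -
  have "(\<exists>y. g x y = 0) \<longleftrightarrow> (\<exists>N::nat. \<exists>y\<le>real N. g x y = 0)" for x
    by (meson real_arch_simple)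
  moreover have "Measurable.pred M (\<lambda>x. \<exists>N::nat. \<exists>y\<le>real N. g x y = 0)"
    by (intro pred_intros_countable(2) pred_ex_zero_le assms)
  ultimately show ?thesis by simp
qed

subsection \<open>Eigenvalues and determinants\<close>

abbreviation sq_mat :: "nat \<Rightarrow> (nat \<Rightarrow> nat \<Rightarrow> 'a) \<Rightarrow> 'a mat" where
  "sq_mat m A \<equiv> Matrix.mat m m (\<lambda>(i, j). A i j)"

text \<open>The Leibniz formula displays the determinant as a polynomial in the entries, so
  measurability and continuity pass from the entries to it.\<close>

lemma det_sq_mat:
  "Determinant.det (sq_mat m A) = (\<Sum>p | p permutes {0..<m}. signof p * (\<Prod>i = 0..<m. A i (p i)))"
proof -
  have "(\<Prod>i = 0..<m. sq_mat m A $$ (i, p i)) = (\<Prod>i = 0..<m. A i (p i))" if "p permutes {0..<m}" for p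
    using permutes_in_image[OF that] by (intro prod.cong) auto
  then show ?thesis
    by (subst det_def'[OF mat_carrier]) simp
qed

lemma borel_measurable_det:
  fixes A :: "'a \<Rightarrow> nat \<Rightarrow> nat \<Rightarrow> real"
  assumes "\<And>i j. i < m \<Longrightarrow> j < m \<Longrightarrow> (\<lambda>x. A x i j) \<in> borel_measurable M"
  shows "(\<lambda>x. Determinant.det (sq_mat m (A x))) \<in> borel_measurable M"
  unfolding det_sq_mat
proof (intro borel_measurable_sum borel_measurable_times borel_measurable_const borel_measurable_prod)
  fix p i
  assume "p \<in> {p. p permutes {0..<m}}" "i \<in> {0..<m}"
  then show "(\<lambda>x. A x i (p i)) \<in> borel_measurable M"
    using permutes_in_image[of p "{0..<m}" i] by (intro assms) auto
qed

lemma continuous_on_det: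
  fixes A :: "'a::topological_space \<Rightarrow> nat \<Rightarrow> nat \<Rightarrow> real"
  assumes "\<And>i j. i < m \<Longrightarrow> j < m \<Longrightarrow> continuous_on S (\<lambda>x. A x i j)"
  shows "continuous_on S (\<lambda>x. Determinant.det (sq_mat m (A x)))"
  unfolding det_sq_mat
proof (rule continuous_on_sum, rule continuous_on_mult, rule continuous_on_const, rule continuous_on_prod)
  fix p i
  assume "p \<in> {p. p permutes {0..<m}}" "i \<in> {0..<m}"
  then show "continuous_on S (\<lambda>x. A x i (p i))"
    using permutes_in_image[of p "{0..<m}" i] by (intro assms) auto
qed

lemma mult_sq_mat_vec:
  assumes "dim_vec v = m" "i < m"
  shows "vec_index (mult_mat_vec (sq_mat m A) v) i = (\<Sum>j<m. A i j * vec_index v j)"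
proof -
  have "vec_index (mult_mat_vec (sq_mat m A) v) i = (\<Sum>j\<in>{0..<m}. Matrix.row (sq_mat m A) i $ j * vec_index v j)"
    using assms(2) by (simp add: scalar_prod_def assms(1))
  also have "\<dots> = (\<Sum>j\<in>{0..<m}. A i j * vec_index v j)"
    using assms(2) by (intro sum.cong) auto
  finally show ?thesis by (simp only: atLeast0LessThan)
qed

text \<open>Enumerating \<open>I\<close> by \<open>e\<close> turns an eigenvector into a nonzero
  kernel vector of an ordinary square matrix, and such a vector exists iff the determinant
  vanishes.\<close>

lemma eigenvalues_on_iff_det:
  fixes M :: "'i \<Rightarrow> 'i \<Rightarrow> real"
  assumes e: "bij_betw e {..<m} I"
  shows "r \<in> eigenvalues_on I M \<longleftrightarrow>
    Determinant.det (sq_mat m (\<lambda>i j. M (e i) (e j) - (if i = j then r else 0))) = 0"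
proof -
  let ?A = "sq_mat m (\<lambda>i j. M (e i) (e j) - (if i = j then r else 0))"
  have A: "?A \<in> carrier_mat m m" by simp
  have sum_e: "(\<Sum>t\<in>I. M (e i) t * v t) - r * v (e i) =
      (\<Sum>j<m. (M (e i) (e j) - (if i = j then r else 0)) * v (e j))" if "i < m" for i v
  proof -
    have "(\<Sum>j<m. (if i = j then r else 0) * v (e j)) = (\<Sum>j<m. if i = j then r * v (e j) else 0)"
      by (intro sum.cong) auto
    also have "\<dots> = r * v (e i)" using that by simp
    finally show ?thesis
      by (simp add: sum.reindex_bij_betw[OF e, symmetric] left_diff_distrib sum_subtractf)
  qed
  have ball_e: "(\<forall>s\<in>I. Q s) \<longleftrightarrow> (\<forall>i<m. Q (e i))" for Q
    using bij_betw_imp_surj_on[OF e] by auto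
  have "r \<in> eigenvalues_on I M \<longleftrightarrow>
      (\<exists>v. \<not> (\<forall>i<m. v (e i) = 0) \<and>
        (\<forall>i<m. (\<Sum>j<m. (M (e i) (e j) - (if i = j then r else 0)) * v (e j)) = 0))"
  proof -
    have 1: "(\<exists>s\<in>I. v s \<noteq> 0) \<longleftrightarrow> \<not> (\<forall>i<m. v (e i) = 0)" for v :: "'i \<Rightarrow> real"
      using ball_e[of "\<lambda>s. v s = 0"] by blast
    have 2: "(\<forall>s\<in>I. (\<Sum>t\<in>I. M s t * v t) = r * v s) \<longleftrightarrow>
        (\<forall>i<m. (\<Sum>j<m. (M (e i) (e j) - (if i = j then r else 0)) * v (e j)) = 0)" for v
      unfolding ball_e by (intro all_cong1 imp_cong refl) (subst sum_e[symmetric], auto)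
    show ?thesis
      unfolding eigenvalues_on_def mem_Collect_eq 1 2 ..
  qed
  also have "\<dots> \<longleftrightarrow> (\<exists>w. w \<in> carrier_vec m \<and> w \<noteq> 0\<^sub>v m \<and> ?A *\<^sub>v w = 0\<^sub>v m)"
  proof
    assume "\<exists>v. \<not> (\<forall>i<m. v (e i) = 0) \<and>
        (\<forall>i<m. (\<Sum>j<m. (M (e i) (e j) - (if i = j then r else 0)) * v (e j)) = 0)"
    then obtain v where v: "\<not> (\<forall>i<m. v (e i) = 0)"
        "\<And>i. i < m \<Longrightarrow> (\<Sum>j<m. (M (e i) (e j) - (if i = j then r else 0)) * v (e j)) = 0"
      by blast
    show "\<exists>w. w \<in> carrier_vec m \<and> w \<noteq> 0\<^sub>v m \<and> ?A *\<^sub>v w = 0\<^sub>v m"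
    proof (intro exI[of _ "Matrix.vec m (\<lambda>i. v (e i))"] conjI)
      show "Matrix.vec m (\<lambda>i. v (e i)) \<noteq> 0\<^sub>v m"
        using v(1) by (metis index_vec index_zero_vec(1))
      show "?A *\<^sub>v Matrix.vec m (\<lambda>i. v (e i)) = 0\<^sub>v m"
        using v(2) by (intro eq_vecI) (auto simp: scalar_prod_def atLeast0LessThan)
    qed auto
  next
    assume "\<exists>w. w \<in> carrier_vec m \<and> w \<noteq> 0\<^sub>v m \<and> ?A *\<^sub>v w = 0\<^sub>v m"
    then obtain w where w: "dim_vec w = m" "w \<noteq> 0\<^sub>v m" "?A *\<^sub>v w = 0\<^sub>v m"
      using carrier_vecD by blast
    let ?v = "\<lambda>s. vec_index w (inv_into {..<m} e s)"
    have v: "?v (e i) = vec_index w i" if "i < m" for i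
      using that e by (simp add: bij_betw_def inv_into_f_f)
    show "\<exists>v. \<not> (\<forall>i<m. v (e i) = 0) \<and>
        (\<forall>i<m. (\<Sum>j<m. (M (e i) (e j) - (if i = j then r else 0)) * v (e j)) = 0)"
    proof (intro exI[of _ ?v] conjI allI impI)
      show "\<not> (\<forall>i<m. ?v (e i) = 0)"
      proof
        assume "\<forall>i<m. ?v (e i) = 0"
        then have "w = 0\<^sub>v m" using w(1) v by (intro eq_vecI) auto
        with w(2) show False ..
      qed
      fix i assume i: "i < m"
      have "(\<Sum>j<m. (M (e i) (e j) - (if i = j then r else 0)) * ?v (e j)) =
          (\<Sum>j<m. (M (e i) (e j) - (if i = j then r else 0)) * vec_index w j)"
        by (rule sum.cong) (simp_all only: v lessThan_iff)
      also have "\<dots> = vec_index (?A *\<^sub>v w) i"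
        by (rule mult_sq_mat_vec[OF w(1) i, symmetric])
      also have "\<dots> = 0"
        unfolding w(3) using i by simp
      finally show "(\<Sum>j<m. (M (e i) (e j) - (if i = j then r else 0)) * ?v (e j)) = 0" .
    qed
  qed
  also have "\<dots> \<longleftrightarrow> Determinant.det ?A = 0"
    using det_0_iff_vec_prod_zero[OF A] by simp
  finally show ?thesis .
qed

text \<open>Eigenvalues are the roots of the characteristic polynomial, which is monic and so
  nonzero. Finiteness makes \<open>Min\<close> of a nonempty spectrum a true minimum.\<close>

lemma finite_eigenvalues_on:
  assumes "finite I"
  shows "finite (eigenvalues_on I M)"
proof -
  obtain e where e: "bij_betw e {..<card I} I"
    using ex_bij_betw_nat_finite[OF assms] by (auto simp: atLeast0LessThan)
  let ?A = "sq_mat (card I) (\<lambda>i j. M (e i) (e j))"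
  have A: "?A \<in> carrier_mat (card I) (card I)" by simp
  have "r \<in> eigenvalues_on I M \<longleftrightarrow> poly (char_poly ?A) r = 0" for r
  proof -
    have "char_matrix ?A r = sq_mat (card I) (\<lambda>i j. M (e i) (e j) - (if i = j then r else 0))"
      unfolding char_matrix_def by (intro eq_matI) auto
    then show ?thesis
      using eigenvalue_root_char_poly[OF A, of r] eigenvalue_det[OF A, of r] eigenvalues_on_iff_det[OF e, of r M]
      by (simp only:)
  qed
  then have "eigenvalues_on I M = {r. poly (char_poly ?A) r = 0}"
    by blast
  moreover have "char_poly ?A \<noteq> 0"
    using degree_monic_char_poly[OF A] by auto
  ultimately show ?thesis
    by (simp add: poly_roots_finite)
qed

text \<open>
  The spectrum may be empty here, and \<open>Min {}\<close> is then an unspecified constant.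
\<close>

lemma pred_Min_eigenvalues_gt:
  fixes A :: "'a \<Rightarrow> 'i \<Rightarrow> 'i \<Rightarrow> real"
  assumes I: "finite I"
    and A: "\<And>s t. s \<in> I \<Longrightarrow> t \<in> I \<Longrightarrow> (\<lambda>x. A x s t) \<in> borel_measurable M"
  shows "Measurable.pred M (\<lambda>x. Min (eigenvalues_on I (A x)) > c)"
proof -
  obtain e where e: "bij_betw e {..<card I} I"
    using ex_bij_betw_nat_finite[OF I] by (auto simp: atLeast0LessThan)
  define g where "g x r = Determinant.det (sq_mat (card I) (\<lambda>i j. A x (e i) (e j) - (if i = j then r else 0)))"
    for x r
  have r: "r \<in> eigenvalues_on I (A x) \<longleftrightarrow> g x r = 0" for x r
    unfolding g_def by (rule eigenvalues_on_iff_det[OF e])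
  have g1: "continuous_on UNIV (g x)" for x
  proof -
    have "continuous_on UNIV (\<lambda>r::real. if i = j then r else 0)" for i j :: nat
      by (cases "i = j") auto
    then show ?thesis
      unfolding g_def by (intro continuous_on_det continuous_intros)
  qed
  have "e i \<in> I" if "i < card I" for i
    using e that by (auto simp: bij_betw_def)
  then have g2: "(\<lambda>x. g x r) \<in> borel_measurable M" for r
    unfolding g_def by (intro borel_measurable_det borel_measurable_diff A) auto
  \<comment> \<open>A finite nonempty spectrum has its minimum above \<open>c\<close> iff
    \<open>g x\<close> has no zero on the half-line up to \<open>c\<close>; in the empty case the
    condition is one fixed truth value.\<close>
  have "Min (eigenvalues_on I (A x)) > c \<longleftrightarrow>
      (if \<exists>r. g x r = 0 then \<not> (\<exists>r\<le>c. g x r = 0) else Min {} > c)" for x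
  proof (cases "\<exists>r. g x r = 0")
    case True
    then show ?thesis
      by (subst Min_gr_iff) (auto simp: finite_eigenvalues_on[OF I] r not_le)
  next
    case False
    then have "eigenvalues_on I (A x) = {}" using r by blast
    with False show ?thesis by simp
  qed
  moreover have "Measurable.pred M (\<lambda>x. if \<exists>r. g x r = 0 then \<not> (\<exists>r\<le>c. g x r = 0) else Min {} > c)"
    using pred_ex_zero[OF g1 g2] pred_ex_zero_le[OF g1 g2, of c] by measurable
  ultimately show ?thesis by simp
qed

subsection \<open>Weighted least squares\<close>

text \<open>Only the coordinate \<open>e k\<close> needs a formula, because the estimator reads off
  a single coefficient; for the others existence suffices. A quotient of determinants is measurable
  in the data.\<close>

lemma cramer_solution:
  fixes B :: "'i \<Rightarrow> 'i \<Rightarrow> real"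
  assumes e: "bij_betw e {..<m} I" and k: "k < m"
    and det: "Determinant.det (sq_mat m (\<lambda>i j. B (e i) (e j))) \<noteq> 0"
  obtains a where "\<And>s. s \<in> I \<Longrightarrow> (\<Sum>t\<in>I. B s t * a t) = b s"
    and "a (e k) = Determinant.det (sq_mat m (\<lambda>i j. if j = k then b (e i) else B (e i) (e j)))
                     / Determinant.det (sq_mat m (\<lambda>i j. B (e i) (e j)))"
proof -
  let ?A = "sq_mat m (\<lambda>i j. B (e i) (e j))"
  let ?b = "Matrix.vec m (\<lambda>i. b (e i))"
  have A: "?A \<in> carrier_mat m m" by simp
  \<comment> \<open>A nonzero determinant makes \<open>?A\<close> a unit of the matrix ring, hence
    invertible; \<open>()\<close> fills the extra slot of the ring record.\<close>
  obtain C where C: "C \<in> carrier_mat m m" "?A * C = 1\<^sub>m m"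
    using det_non_zero_imp_unit[OF A det, of "()"]
    unfolding Units_def ring_mat_simps by auto
  define x where "x = C *\<^sub>v ?b"
  have x: "x \<in> carrier_vec m" unfolding x_def using C(1) by simp
  have Ax: "?A *\<^sub>v x = ?b"
    unfolding x_def using C by (subst assoc_mult_mat_vec[symmetric, OF A]) auto
  define a where "a s = vec_index x (inv_into {..<m} e s)" for s
  have a: "a (e i) = vec_index x i" if "i < m" for i
    using that e by (simp add: a_def bij_betw_def inv_into_f_f)
  show thesis
  proof (rule that[of a])
    fix s assume "s \<in> I"
    then obtain i where i: "i < m" "s = e i"
      using bij_betw_imp_surj_on[OF e] by auto
    have "(\<Sum>t\<in>I. B s t * a t) = (\<Sum>j<m. B (e i) (e j) * a (e j))"
      by (simp add: sum.reindex_bij_betw[OF e, symmetric] i(2))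
    also have "\<dots> = (\<Sum>j<m. B (e i) (e j) * vec_index x j)"
      by (intro sum.cong refl) (simp only: a lessThan_iff)
    also have "\<dots> = vec_index (?A *\<^sub>v x) i"
      using x i(1) by (intro mult_sq_mat_vec[symmetric]) auto
    also have "\<dots> = b s"
      unfolding Ax using i by simp
    finally show "(\<Sum>t\<in>I. B s t * a t) = b s" .
  next
    have "replace_col ?A (?A *\<^sub>v x) k = sq_mat m (\<lambda>i j. if j = k then b (e i) else B (e i) (e j))"
      unfolding Ax replace_col_def by (intro eq_matI) auto
    with cramer_lemma_mat[OF A x k] det
    show "a (e k) = Determinant.det (sq_mat m (\<lambda>i j. if j = k then b (e i) else B (e i) (e j)))
                     / Determinant.det ?A"
      by (simp add: a[OF k] field_simps)
  qed
qed

text \<open>Pythagoras for the weighted bilinear form: the normal equations make the residual of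
  \<open>a\<close> orthogonal to every column of the design, so the cross term vanishes.\<close>

lemma weighted_least_squares_decomp:
  fixes w y :: "'k \<Rightarrow> real" and \<phi> :: "'k \<Rightarrow> 'i \<Rightarrow> real"
  assumes normal: "\<And>s. s \<in> I \<Longrightarrow>
    (\<Sum>t\<in>I. (\<Sum>i\<in>J. w i * \<phi> i s * \<phi> i t) * a t) = (\<Sum>i\<in>J. w i * \<phi> i s * y i)"
  shows "(\<Sum>i\<in>J. (y i - (\<Sum>s\<in>I. b s * \<phi> i s))\<^sup>2 * w i) =
    (\<Sum>i\<in>J. (y i - (\<Sum>s\<in>I. a s * \<phi> i s))\<^sup>2 * w i) +
    (\<Sum>i\<in>J. (\<Sum>s\<in>I. (b s - a s) * \<phi> i s)\<^sup>2 * w i)"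
proof -
  \<comment> \<open>The cross term is regrouped by the coefficients \<open>b s - a s\<close>; the
    factor of each is the difference of the two sides of its normal equation.\<close>
  have "(\<Sum>i\<in>J. (y i - (\<Sum>t\<in>I. a t * \<phi> i t)) * (\<Sum>s\<in>I. (b s - a s) * \<phi> i s) * w i) =
      (\<Sum>i\<in>J. \<Sum>s\<in>I. (b s - a s) * (w i * \<phi> i s * y i - (\<Sum>t\<in>I. w i * \<phi> i s * \<phi> i t * a t)))"
    by (intro sum.cong refl)
       (simp add: sum_distrib_left sum_distrib_right algebra_simps sum_subtractf sum.distrib)
  also have "\<dots> = (\<Sum>s\<in>I. (b s - a s) * ((\<Sum>i\<in>J. w i * \<phi> i s * y i) -
      (\<Sum>i\<in>J. \<Sum>t\<in>I. w i * \<phi> i s * \<phi> i t * a t)))"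
    by (subst sum.swap) (simp only: sum_distrib_left[symmetric] sum_subtractf)
  also have "\<dots> = (\<Sum>s\<in>I. (b s - a s) * ((\<Sum>i\<in>J. w i * \<phi> i s * y i) -
      (\<Sum>t\<in>I. (\<Sum>i\<in>J. w i * \<phi> i s * \<phi> i t) * a t)))"
  proof -
    have "(\<Sum>i\<in>J. \<Sum>t\<in>I. w i * \<phi> i s * \<phi> i t * a t) =
        (\<Sum>t\<in>I. (\<Sum>i\<in>J. w i * \<phi> i s * \<phi> i t) * a t)" for s
      unfolding sum_distrib_right by (rule sum.swap)
    then show ?thesis by (simp only:)
  qed
  also have "\<dots> = 0"
    using normal by simp
  finally have cross: "(\<Sum>i\<in>J. (y i - (\<Sum>t\<in>I. a t * \<phi> i t)) * (\<Sum>s\<in>I. (b s - a s) * \<phi> i s) * w i) = 0" .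
  have "(y i - (\<Sum>s\<in>I. b s * \<phi> i s))\<^sup>2 * w i =
      (y i - (\<Sum>s\<in>I. a s * \<phi> i s))\<^sup>2 * w i + (\<Sum>s\<in>I. (b s - a s) * \<phi> i s)\<^sup>2 * w i
      - 2 * ((y i - (\<Sum>t\<in>I. a t * \<phi> i t)) * (\<Sum>s\<in>I. (b s - a s) * \<phi> i s) * w i)" for i
  proof -
    have "(\<Sum>s\<in>I. b s * \<phi> i s) = (\<Sum>s\<in>I. a s * \<phi> i s) + (\<Sum>s\<in>I. (b s - a s) * \<phi> i s)"
      by (simp add: sum.distrib[symmetric] algebra_simps)
    then show ?thesis
      by (simp add: power2_eq_square algebra_simps)
  qed
  then show ?thesis
    by (simp add: sum.distrib sum_subtractf cross flip: sum_distrib_left)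
qed

text \<open>A vanishing sum of nonnegative terms has only zero terms, so each
  \<open>w i * (\<Sum>t\<in>I. v t * \<phi> i t)\<close> is zero, and the Gram matrix maps
  \<open>v\<close> to a combination of these.\<close>

lemma gram_kernel:
  fixes w :: "'k \<Rightarrow> real" and \<phi> :: "'k \<Rightarrow> 'i \<Rightarrow> real"
  assumes J: "finite J" and w: "\<And>i. i \<in> J \<Longrightarrow> 0 \<le> w i"
    and zero: "(\<Sum>i\<in>J. (\<Sum>t\<in>I. v t * \<phi> i t)\<^sup>2 * w i) = 0"
  shows "(\<Sum>t\<in>I. (\<Sum>i\<in>J. w i * \<phi> i s * \<phi> i t) * v t) = 0"
proof -
  have "(\<Sum>t\<in>I. v t * \<phi> i t)\<^sup>2 * w i = 0" if "i \<in> J" for i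
    using zero w that by (subst (asm) sum_nonneg_eq_0_iff[OF J]) auto
  then have *: "w i * (\<Sum>t\<in>I. v t * \<phi> i t) = 0" if "i \<in> J" for i
    using that by auto
  have "(\<Sum>t\<in>I. (\<Sum>i\<in>J. w i * \<phi> i s * \<phi> i t) * v t) = (\<Sum>i\<in>J. \<phi> i s * (w i * (\<Sum>t\<in>I. v t * \<phi> i t)))"
    by (simp add: sum_distrib_left sum_distrib_right mult_ac) (rule sum.swap)
  also have "\<dots> = 0"
    using * by (intro sum.neutral) simp
  finally show ?thesis .
qed

subsection \<open>Measurability of the estimator\<close>

lemma finite_multi_indices: "finite (multi_indices d k)"
proof (rule finite_subset)
  show "multi_indices d k \<subseteq> {s. \<forall>i. (i \<in> {..<d} \<longrightarrow> s i \<in> {..k}) \<and> (i \<notin> {..<d} \<longrightarrow> s i = 0)}"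
  proof (intro subsetI CollectI allI)
    fix s i
    assume s: "s \<in> multi_indices d k"
    have "s i \<le> k" if "i < d"
    proof -
      have "s i \<le> (\<Sum>i<d. s i)" using that by (intro member_le_sum) auto
      with s show ?thesis by (simp add: multi_indices_def)
    qed
    with s show "(i \<in> {..<d} \<longrightarrow> s i \<in> {..k}) \<and> (i \<notin> {..<d} \<longrightarrow> s i = 0)"
      by (simp add: multi_indices_def)
  qed
qed (rule finite_set_of_finite_funs; simp)

lemma zero_in_multi_indices: "(\<lambda>_. 0) \<in> multi_indices d k"
  by (simp add: multi_indices_def)

lemma mpow_zero:
  assumes "s \<in> multi_indices d k"
  shows "mpow d (\<lambda>_. 0) s = of_bool (s = (\<lambda>_. 0))"
proof (cases "s = (\<lambda>_. 0)")
  case False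
  then obtain i where i: "s i \<noteq> 0" by auto
  then have "i < d" using assms by (metis (mono_tags, lifting) mem_Collect_eq multi_indices_def not_le)
  with i have "\<exists>j\<in>{..<d}. (0::real) ^ s j = 0" by (intro bexI[of _ i]) auto
  then have "mpow d (\<lambda>_. 0) s = 0" by (simp add: mpow_def)
  with False show ?thesis by simp
qed (simp add: mpow_def)

lemma mpow_divide:
  fixes h :: real
  shows "mpow d (\<lambda>j. u j / h) s = mpow d u s / h ^ (\<Sum>j<d. s j)"
  by (simp add: mpow_def power_divide prod_dividef power_sum)

lemma mpow_scaled_diff: "mpow d (scaled_diff d h x z) s = mpow d (\<lambda>j. (z j - x j) / h) s"
  by (simp add: mpow_def scaled_diff_def)

lemma mpow_add: "mpow d u (\<lambda>j. s j + t j) = mpow d u s * mpow d u t"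
  by (simp add: mpow_def power_add prod.distrib)

lemma scaled_diff_in_Rd: "scaled_diff d h x z \<in> Rd d"
  by (simp add: scaled_diff_def Rd_def)

text \<open>Coefficients refer to monomials in \<open>u / h\<close>, as in \<open>B_bar\<close>,
  which makes \<open>B_bar\<close> the matrix of the normal equations up to normalization. The
  constant coefficient is not affected by the scaling.\<close>

definition scaled_poly :: "nat \<Rightarrow> nat \<Rightarrow> real \<Rightarrow> ((nat \<Rightarrow> nat) \<Rightarrow> real) \<Rightarrow> (nat \<Rightarrow> real) \<Rightarrow> real" where
  "scaled_poly d l h a u = (\<Sum>s\<in>multi_indices d l. a s * mpow d (\<lambda>j. u j / h) s)"

lemma poly_funs_eq_range:
  assumes "h \<noteq> 0"
  shows "poly_funs d l = range (scaled_poly d l h)"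
proof (intro equalityI subsetI)
  fix p assume "p \<in> poly_funs d l"
  then obtain c where c: "p = (\<lambda>u. \<Sum>s\<in>multi_indices d l. c s * mpow d u s)"
    by (auto simp: poly_funs_def)
  have "p = scaled_poly d l h (\<lambda>s. c s * h ^ (\<Sum>j<d. s j))"
    using assms by (simp add: c scaled_poly_def mpow_divide fun_eq_iff)
  then show "p \<in> range (scaled_poly d l h)" by blast
next
  fix p assume "p \<in> range (scaled_poly d l h)"
  then obtain a where a: "p = scaled_poly d l h a" by blast
  show "p \<in> poly_funs d l"
    unfolding poly_funs_def mem_Collect_eq
    by (rule exI[of _ "\<lambda>s. a s / h ^ (\<Sum>j<d. s j)"])
       (simp add: a scaled_poly_def mpow_divide fun_eq_iff)
qed

lemma scaled_poly_zero: "scaled_poly d l h a (\<lambda>_. 0) = a (\<lambda>_. 0)"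
proof -
  have "scaled_poly d l h a (\<lambda>_. 0) = (\<Sum>s\<in>multi_indices d l. if s = (\<lambda>_. 0) then a s else 0)"
    unfolding scaled_poly_def by (intro sum.cong refl) (simp add: mpow_zero)
  then show ?thesis
    by (simp add: finite_multi_indices zero_in_multi_indices)
qed

text \<open>
  The matrix \<^const>\<open>B_bar\<close> is a multiple of the Gram matrix of the weighted design, hence positive
  semidefinite; excluding the eigenvalue \<open>0\<close> therefore makes the minimizer unique.
\<close>

lemma lp_estimator_eq:
  assumes n: "n \<ge> 1" and h: "h > 0" and K: "\<And>u. u \<in> Rd d \<Longrightarrow> 0 \<le> K u"
    and nz: "0 \<notin> eigenvalues_on (multi_indices d l) (B_bar d n h K \<omega> x)"
    and normal: "\<And>s. s \<in> multi_indices d l \<Longrightarrow>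
      (\<Sum>t\<in>multi_indices d l. B_bar d n h K \<omega> x s t * a t) =
      1 / (real n * h ^ d) * (\<Sum>i<n. K (scaled_diff d h x (fst (\<omega> i))) *
         mpow d (scaled_diff d h x (fst (\<omega> i))) s * of_bool (snd (\<omega> i)))"
  shows "lp_estimator d l n h K \<omega> x = a (\<lambda>_. 0)"
proof -
  let ?I = "multi_indices d l"
  let ?P = "scaled_poly d l h"
  define u where "u i = scaled_diff d h x (fst (\<omega> i))" for i
  define w where "w i = K (u i)" for i
  define \<phi> where "\<phi> i s = mpow d (u i) s" for i s
  define y where "y i = (of_bool (snd (\<omega> i)) :: real)" for i
  have w: "0 \<le> w i" for i
    unfolding w_def u_def by (intro K scaled_diff_in_Rd)
  have B: "B_bar d n h K \<omega> x s t = 1 / (real n * h ^ d) * (\<Sum>i<n. w i * \<phi> i s * \<phi> i t)" for s t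
    unfolding B_bar_def w_def \<phi>_def u_def mpow_add by (simp add: mult_ac)
  have sum_B: "(\<Sum>t\<in>?I. B_bar d n h K \<omega> x s t * v t) =
      1 / (real n * h ^ d) * (\<Sum>t\<in>?I. (\<Sum>i<n. w i * \<phi> i s * \<phi> i t) * v t)" for s v
    unfolding B by (simp only: sum_distrib_left[of "1 / (real n * h ^ d)" _ ?I] mult.assoc)
  have normal': "(\<Sum>t\<in>?I. (\<Sum>i<n. w i * \<phi> i s * \<phi> i t) * a t) = (\<Sum>i<n. w i * \<phi> i s * y i)"
    if "s \<in> ?I" for s
    using normal[OF that] n h unfolding sum_B by (simp add: w_def \<phi>_def u_def y_def)
  have obj: "lp_objective d n h K \<omega> x (?P b) = (\<Sum>i<n. (y i - (\<Sum>s\<in>?I. b s * \<phi> i s))\<^sup>2 * w i)" for b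
    by (simp add: lp_objective_def scaled_poly_def y_def w_def \<phi>_def u_def mpow_scaled_diff)
  have excess: "lp_objective d n h K \<omega> x (?P b) =
      lp_objective d n h K \<omega> x (?P a) + (\<Sum>i<n. (\<Sum>s\<in>?I. (b s - a s) * \<phi> i s)\<^sup>2 * w i)" for b
    unfolding obj using normal' by (rule weighted_least_squares_decomp)
  have nonneg: "0 \<le> (\<Sum>i<n. (\<Sum>s\<in>?I. (b s - a s) * \<phi> i s)\<^sup>2 * w i)" for b
    using w by (intro sum_nonneg) simp
  \<comment> \<open>If \<open>b\<close> does no worse than \<open>a\<close>, the excess vanishes and
    \<open>b - a\<close> lies in the kernel of the Gram matrix; a nonzero entry would make it an
    eigenvector for the eigenvalue 0.\<close>
  have uniq: "?P b = ?P a" if "lp_objective d n h K \<omega> x (?P b) \<le> lp_objective d n h K \<omega> x (?P a)" for b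
  proof -
    have "(\<Sum>i<n. (\<Sum>s\<in>?I. (b s - a s) * \<phi> i s)\<^sup>2 * w i) = 0"
      using excess[of b] nonneg[of b] that by linarith
    from gram_kernel[OF _ _ this] w
    have *: "(\<Sum>t\<in>?I. B_bar d n h K \<omega> x s t * (b t - a t)) = 0 * (b s - a s)" for s
      unfolding sum_B by simp
    have "b s - a s = 0" if "s \<in> ?I" for s
    proof (rule ccontr)
      assume "b s - a s \<noteq> 0"
      with that * have "0 \<in> eigenvalues_on ?I (B_bar d n h K \<omega> x)"
        unfolding eigenvalues_on_def mem_Collect_eq by (intro exI[of _ "\<lambda>s. b s - a s"] conjI bexI[of _ s] ballI)
      with nz show False ..
    qed
    then have eq: "b s = a s" if "s \<in> ?I" for s
      using that eq_iff_diff_eq_0[of "b s" "a s"] by blast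
    show ?thesis
    proof
      show "?P b u = ?P a u" for u
        unfolding scaled_poly_def by (rule sum.cong) (simp_all only: eq)
    qed
  qed
  have minimizer_iff: "lp_minimizer d l n h K \<omega> x p \<longleftrightarrow>
      p \<in> range ?P \<and> (\<forall>b. lp_objective d n h K \<omega> x p \<le> lp_objective d n h K \<omega> x (?P b))" for p
  proof -
    have "\<not> (\<exists>q. q \<in> range ?P \<and> f q < f p) \<longleftrightarrow> (\<forall>b. f p \<le> f (?P b))" for f :: "_ \<Rightarrow> real"
      unfolding not_less[symmetric] by blast
    then show ?thesis
      unfolding lp_minimizer_def is_arg_min_def poly_funs_eq_range[OF less_imp_neq[OF h, symmetric]]
      by (simp only:)
  qed
  have "lp_minimizer d l n h K \<omega> x p \<longleftrightarrow> p = ?P a" for p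
  proof
    assume "lp_minimizer d l n h K \<omega> x p"
    then show "p = ?P a"
      unfolding minimizer_iff using uniq by blast
  next
    assume p: "p = ?P a"
    show "lp_minimizer d l n h K \<omega> x p"
      unfolding minimizer_iff p
    proof (intro conjI rangeI allI)
      show "lp_objective d n h K \<omega> x (?P a) \<le> lp_objective d n h K \<omega> x (?P b)" for b
        using excess[of b] nonneg[of b] by linarith
    qed
  qed
  then have "lp_minimizer d l n h K \<omega> x = (\<lambda>p. p = ?P a)"
    by (rule ext)
  then have "lp_estimator d l n h K \<omega> x = ?P a (\<lambda>_. 0)"
    by (simp add: lp_estimator_def)
  then show ?thesis by (simp add: scaled_poly_zero)
qed

text \<open>A minimizer chosen by \<open>THE\<close> carries no measurability, so the estimator is
  rewritten at every point as a case distinction between a clipped quotient of determinants and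
  0.\<close>

lemma borel_measurable_eta_star:
  fixes P :: "((nat \<Rightarrow> real) \<times> bool) measure"
  assumes P: "sets P = sets (leb_Rd d \<Otimes>\<^sub>M count_space UNIV)"
    and K [measurable]: "K \<in> borel_measurable (leb_Rd d)" and K0: "\<And>u. u \<in> Rd d \<Longrightarrow> 0 \<le> K u"
    and n: "n \<ge> 1" and h: "h > 0"
  shows "(\<lambda>(\<omega>, x). eta_star d \<beta> n h K \<omega> x) \<in> borel_measurable (sample_law n P \<Otimes>\<^sub>M leb_Rd d)"
proof -
  let ?N = "sample_law n P \<Otimes>\<^sub>M leb_Rd d"
  let ?I = "multi_indices d (strict_floor \<beta>)"
  define m where "m = card ?I"
  obtain e where e: "bij_betw e {..<m} ?I"
    using ex_bij_betw_nat_finite[OF finite_multi_indices] by (auto simp: m_def atLeast0LessThan)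
  \<comment> \<open>\<open>k\<close> is the position of the zero multi-index, whose coefficient is
    the value of the estimator.\<close>
  obtain k where k: "k < m" "e k = (\<lambda>_. 0)"
    using bij_betw_imp_surj_on[OF e] zero_in_multi_indices[of d "strict_floor \<beta>"]
    by (metis imageE lessThan_iff)
  have sample: "(\<lambda>z. fst z i) \<in> ?N \<rightarrow>\<^sub>M (leb_Rd d \<Otimes>\<^sub>M count_space UNIV)" if "i < n" for i
  proof -
    have "(\<lambda>\<omega>. \<omega> i) \<in> sample_law n P \<rightarrow>\<^sub>M P"
      unfolding sample_law_def using that by (intro measurable_component_singleton) auto
    from measurable_compose[OF measurable_fst this] show ?thesis
      by (simp add: measurable_cong_sets[OF refl P])
  qed
  have coord: "(\<lambda>x. x j) \<in> borel_measurable (leb_Rd d)" if "j < d" for j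
    unfolding leb_Rd_def using that
    by (subst measurable_cong_sets[OF refl sets_lborel[symmetric]])
       (rule measurable_component_singleton, auto)
  have u_coord: "(\<lambda>z. (fst (fst z i) j - snd z j) / h) \<in> borel_measurable ?N"
    if "i < n" "j < d" for i j
  proof -
    note [measurable] = sample[OF that(1)]
    have "(\<lambda>z. fst (fst z i)) \<in> ?N \<rightarrow>\<^sub>M leb_Rd d" by measurable
    from measurable_compose[OF this coord[OF that(2)]] measurable_compose[OF measurable_snd coord[OF that(2)]]
    show ?thesis by measurable
  qed
  have u_meas: "(\<lambda>z. scaled_diff d h (snd z) (fst (fst z i))) \<in> ?N \<rightarrow>\<^sub>M leb_Rd d" if "i < n" for i
    unfolding leb_Rd_def scaled_diff_def
    using u_coord[OF that] by (intro measurable_restrict) (auto simp: leb_Rd_def)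
  have K_meas: "(\<lambda>z. K (scaled_diff d h (snd z) (fst (fst z i)))) \<in> borel_measurable ?N" if "i < n" for i
    using measurable_compose[OF u_meas[OF that] K] .
  have mpow_meas: "(\<lambda>z. mpow d (scaled_diff d h (snd z) (fst (fst z i))) s) \<in> borel_measurable ?N"
    if "i < n" for i s
    unfolding mpow_scaled_diff unfolding mpow_def
    using u_coord[OF that] by (intro borel_measurable_prod borel_measurable_power) auto
  have y_meas: "(\<lambda>z. of_bool (snd (fst z i)) :: real) \<in> borel_measurable ?N" if "i < n" for i
  proof -
    note [measurable] = sample[OF that]
    show ?thesis by measurable
  qed
  define B where "B z s t = B_bar d n h K (fst z) (snd z) s t" for z s t
  have B_meas: "(\<lambda>z. B z s t) \<in> borel_measurable ?N" for s t
    unfolding B_def B_bar_def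
    using mpow_meas K_meas by (intro borel_measurable_times borel_measurable_sum) auto
  have Bz: "B z = B_bar d n h K (fst z) (snd z)" for z
    by (simp add: B_def fun_eq_iff)
  define b where "b z s = 1 / (real n * h ^ d) * (\<Sum>i<n. K (scaled_diff d h (snd z) (fst (fst z i))) *
      mpow d (scaled_diff d h (snd z) (fst (fst z i))) s * of_bool (snd (fst z i)))" for z s
  have b_meas: "(\<lambda>z. b z s) \<in> borel_measurable ?N" for s
    unfolding b_def
    using mpow_meas K_meas y_meas by (intro borel_measurable_times borel_measurable_sum) auto
  define D where "D z = Determinant.det (sq_mat m (\<lambda>i j. B z (e i) (e j)))" for z
  \<comment> \<open>Cramer's numerator: column \<open>k\<close> is replaced by the right-hand side
    of the normal equations.\<close>
  define D0 where "D0 z = Determinant.det (sq_mat m (\<lambda>i j. if j = k then b z (e i) else B z (e i) (e j)))" for z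
  have D_meas [measurable]: "D \<in> borel_measurable ?N"
    unfolding D_def by (intro borel_measurable_det B_meas)
  have D0_meas [measurable]: "D0 \<in> borel_measurable ?N"
    unfolding D0_def
  proof (rule borel_measurable_det)
    show "(\<lambda>z. if j = k then b z (e i) else B z (e i) (e j)) \<in> borel_measurable ?N" for i j
      by (cases "j = k") (simp_all add: B_meas b_meas)
  qed
  have [measurable]: "Measurable.pred ?N (\<lambda>z. Min (eigenvalues_on ?I (B z)) > 1 / ln (real n))"
    using finite_multi_indices B_meas by (rule pred_Min_eigenvalues_gt)
  have "continuous_on UNIV (closest_point {0..1::real})"
    by (intro continuous_on_closest_point) auto
  then have [measurable]: "closest_point {0..1::real} \<in> borel_measurable borel"
    by (rule borel_measurable_continuous_onI)
  have "(case z of (\<omega>, x) \<Rightarrow> eta_star d \<beta> n h K \<omega> x) =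
      (if n > 1 \<and> Min (eigenvalues_on ?I (B z)) > 1 / ln (real n)
       then closest_point {0..1} (D0 z / D z) else 0)" for z
  proof (cases "n > 1 \<and> Min (eigenvalues_on ?I (B z)) > 1 / ln (real n)")
    case True
    \<comment> \<open>The condition \<open>n > 1\<close> makes the threshold positive. An eigenvalue
      0 would then push the minimum to at most 0, a contradiction; this covers an empty spectrum as
      well.\<close>
    then have "0 < 1 / ln (real n)" by simp
    with True have Min: "Min (eigenvalues_on ?I (B z)) > 0" by linarith
    have nz: "0 \<notin> eigenvalues_on ?I (B z)"
      using Min_le[OF finite_eigenvalues_on[OF finite_multi_indices], of 0 d "strict_floor \<beta>" "B z"] Min
      by auto
    then have Dz: "D z \<noteq> 0"
      unfolding D_def using eigenvalues_on_iff_det[OF e, of 0 "B z"] by simp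
    obtain a where a: "\<And>s. s \<in> ?I \<Longrightarrow> (\<Sum>t\<in>?I. B z s t * a t) = b z s"
      "a (e k) = D0 z / D z"
      using cramer_solution[OF e k(1), of "B z" "b z"] Dz unfolding D_def D0_def by blast
    have "lp_estimator d (strict_floor \<beta>) n h K (fst z) (snd z) = a (\<lambda>_. 0)"
      by (rule lp_estimator_eq[OF n h K0]) (use nz a(1) in \<open>simp_all add: Bz b_def\<close>)
    with a(2) k(2) have "lp_estimator d (strict_floor \<beta>) n h K (fst z) (snd z) = D0 z / D z"
      by simp
    with True show ?thesis
      by (simp add: eta_star_def Bz case_prod_beta)
  next
    case False
    then show ?thesis
      by (auto simp: eta_star_def Bz case_prod_beta)
  qed
  then have "(\<lambda>(\<omega>, x). eta_star d \<beta> n h K \<omega> x) =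
      (\<lambda>z. if n > 1 \<and> Min (eigenvalues_on ?I (B z)) > 1 / ln (real n)
        then closest_point {0..1} (D0 z / D z) else 0)"
    by (rule ext)
  moreover have "(\<lambda>z. if n > 1 \<and> Min (eigenvalues_on ?I (B z)) > 1 / ln (real n)
        then closest_point {0..1} (D0 z / D z) else 0) \<in> borel_measurable ?N"
    by measurable
  ultimately show ?thesis by (simp only:)
qed

subsection \<open>Excess risk\<close>

lemma space_leb_Rd: "space (leb_Rd d) = Rd d"
  by (simp add: leb_Rd_def Rd_def space_PiM)

lemma sets_marginal [measurable_cong]: "sets (marginal d P) = sets (leb_Rd d)"
  by (simp add: marginal_def)

lemma space_marginal: "space (marginal d P) = Rd d"
  by (simp add: marginal_def space_leb_Rd)

lemma measurable_fst_joint: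
  assumes "joint_distribution d P"
  shows "fst \<in> P \<rightarrow>\<^sub>M leb_Rd d"
proof -
  have "sets P = sets (leb_Rd d \<Otimes>\<^sub>M count_space UNIV)"
    using assms by (simp add: joint_distribution_def)
  then show ?thesis
    unfolding measurable_cong_sets[OF \<open>sets P = _\<close> refl] by (intro measurable_fst)
qed

lemma space_joint:
  assumes "joint_distribution d P"
  shows "space P = Rd d \<times> UNIV"
proof -
  have "sets P = sets (leb_Rd d \<Otimes>\<^sub>M count_space UNIV)"
    using assms by (simp add: joint_distribution_def)
  from sets_eq_imp_space_eq[OF this] show ?thesis
    by (simp add: space_pair_measure space_leb_Rd)
qed

lemma prob_space_marginal:
  assumes "joint_distribution d P"
  shows "prob_space (marginal d P)"
  unfolding marginal_def
  using assms measurable_fst_joint[OF assms] prob_space.prob_space_distr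
  by (auto simp: joint_distribution_def)

lemma regression_function_measurable:
  assumes "regression_function d P \<eta>"
  shows "\<eta> \<in> borel_measurable (marginal d P)"
  using assms by (simp add: regression_function_def measurable_cong_sets[OF sets_marginal refl])

lemma integrable_marginal_bounded:
  fixes f :: "_ \<Rightarrow> real"
  assumes "joint_distribution d P" "f \<in> borel_measurable (marginal d P)"
    and "\<And>x. x \<in> Rd d \<Longrightarrow> \<bar>f x\<bar> \<le> B"
  shows "integrable (marginal d P) f"
proof -
  interpret prob_space "marginal d P" using assms(1) by (rule prob_space_marginal)
  show ?thesis
    using assms(2,3) by (intro integrable_const_bound[of _ B]) (auto simp: space_marginal)
qed

text \<open>The error event splits by the predicted label. \<open>regression_function\<close>
  prescribes masses for the label \<open>True\<close> only, so the mass of wrong \<open>True\<close>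
  predictions is obtained from the marginal by subtraction.\<close>

lemma risk_eq_integral:
  assumes P: "joint_distribution d P" and \<eta>: "regression_function d P \<eta>"
    and f [measurable]: "Measurable.pred (leb_Rd d) f"
  shows "risk P f = (LINT x|marginal d P. (if f x then 1 - \<eta> x else \<eta> x))"
proof -
  let ?M = "marginal d P"
  interpret P: prob_space P using P by (simp add: joint_distribution_def)
  interpret M: prob_space ?M using P by (rule prob_space_marginal)
  have sets_P: "sets P = sets (leb_Rd d \<Otimes>\<^sub>M count_space UNIV)"
    using P by (simp add: joint_distribution_def)
  have \<eta>01: "\<And>x. x \<in> Rd d \<Longrightarrow> 0 \<le> \<eta> x \<and> \<eta> x \<le> 1"
    and joint: "\<And>A. A \<in> sets (leb_Rd d) \<Longrightarrow> measure P (A \<times> {True}) = (LINT x:A|?M. \<eta> x)"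
    using \<eta> by (auto simp: regression_function_def)
  note [measurable] = regression_function_measurable[OF \<eta>]
  define A where "A = {x \<in> space (leb_Rd d). f x}"
  have A [measurable]: "A \<in> sets (leb_Rd d)" unfolding A_def by measurable
  have A': "Rd d - A \<in> sets (leb_Rd d)"
    using sets.compl_sets[OF A] by (simp add: space_leb_Rd)
  have rect: "B \<times> C \<in> sets P" if "B \<in> sets (leb_Rd d)" for B C
    unfolding sets_P using that by (intro pair_measureI) auto
  have "{z \<in> space P. snd z \<noteq> f (fst z)} = (Rd d - A) \<times> {True} \<union> A \<times> {False}"
    unfolding space_joint[OF P] A_def space_leb_Rd by auto
  then have "risk P f = measure P ((Rd d - A) \<times> {True}) + measure P (A \<times> {False})"
    unfolding risk_def using A A' by (subst P.finite_measure_Union[symmetric]) (auto simp: rect)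
  also have "measure P (A \<times> {False}) = measure P (A \<times> UNIV) - measure P (A \<times> {True})"
  proof -
    have "A \<times> {False} = A \<times> UNIV - A \<times> {True}" by auto
    then show ?thesis
      using A by (simp only:) (intro P.finite_measure_Diff rect, auto)
  qed
  also have "measure P (A \<times> UNIV) = measure ?M A"
  proof -
    have "fst -` A \<inter> space P = A \<times> UNIV"
      using sets.sets_into_space[OF A] by (auto simp: space_joint[OF P] space_leb_Rd)
    then show ?thesis
      unfolding marginal_def by (subst measure_distr[OF measurable_fst_joint[OF P] A]) simp
  qed
  also have "measure P ((Rd d - A) \<times> {True}) + (measure ?M A - measure P (A \<times> {True})) =
      (LINT x|?M. indicator (Rd d - A) x * \<eta> x) + ((LINT x|?M. indicator A x) - (LINT x|?M. indicator A x * \<eta> x))"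
    using A by (simp add: joint[OF A] joint[OF A'] set_lebesgue_integral_def sets_marginal M.emeasure_eq_measure)
  also have "\<dots> = (LINT x|?M. indicator (Rd d - A) x * \<eta> x + (indicator A x - indicator A x * \<eta> x))"
  proof -
    have "integrable ?M \<eta>"
      using \<eta>01 by (intro integrable_marginal_bounded[OF P, of _ 1]) auto
    then have "integrable ?M (\<lambda>x. indicator B x * \<eta> x)" if "B \<in> sets (leb_Rd d)" for B
      using integrable_real_mult_indicator[of B ?M \<eta>] that by (simp add: sets_marginal mult.commute)
    moreover have "integrable ?M (indicator A :: _ \<Rightarrow> real)"
      using A by (intro integrable_real_indicator) (simp_all add: sets_marginal M.emeasure_eq_measure)
    ultimately show ?thesis using A A' by simp
  qed
  also have "\<dots> = (LINT x|?M. (if f x then 1 - \<eta> x else \<eta> x))"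
    by (intro Bochner_Integration.integral_cong refl) (auto simp: A_def space_marginal space_leb_Rd)
  finally show ?thesis .
qed

lemma pred_plug_in:
  assumes [measurable]: "g \<in> borel_measurable M"
  shows "Measurable.pred M (plug_in g)"
  unfolding plug_in_def by measurable

text \<open>Given \<open>x\<close>, predicting \<open>True\<close> costs \<open>1 - \<eta> x\<close>
  and predicting \<open>False\<close> costs \<open>\<eta> x\<close>. The Bayes rule picks the
  cheaper label, so disagreement costs the gap and agreement nothing.\<close>

lemma excess_risk_eq:
  assumes P: "joint_distribution d P" and \<eta>: "regression_function d P \<eta>"
    and f [measurable]: "Measurable.pred (leb_Rd d) f"
  shows "risk P f - risk P (plug_in \<eta>) =
    (LINT x|marginal d P. 2 * \<bar>\<eta> x - 1/2\<bar> * of_bool (f x \<noteq> plug_in \<eta> x))"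
proof -
  let ?M = "marginal d P"
  note [measurable] = regression_function_measurable[OF \<eta>]
  have \<eta>': "\<eta> \<in> borel_measurable (leb_Rd d)" and \<eta>01: "\<And>x. x \<in> Rd d \<Longrightarrow> 0 \<le> \<eta> x \<and> \<eta> x \<le> 1"
    using \<eta> by (auto simp: regression_function_def)
  note [measurable] = pred_plug_in[OF \<eta>']
  have int: "integrable ?M (\<lambda>x. if g x then 1 - \<eta> x else \<eta> x)" if [measurable]: "Measurable.pred (leb_Rd d) g" for g
  proof (rule integrable_marginal_bounded[OF P, of _ 1])
    show "(\<lambda>x. if g x then 1 - \<eta> x else \<eta> x) \<in> borel_measurable ?M" by measurable
    show "\<bar>if g x then 1 - \<eta> x else \<eta> x\<bar> \<le> 1" if "x \<in> Rd d" for x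
      using \<eta>01[OF that] by auto
  qed
  have "risk P f - risk P (plug_in \<eta>) =
      (LINT x|?M. (if f x then 1 - \<eta> x else \<eta> x) - (if plug_in \<eta> x then 1 - \<eta> x else \<eta> x))"
    using int by (simp add: risk_eq_integral[OF P \<eta>])
  also have "\<dots> = (LINT x|?M. 2 * \<bar>\<eta> x - 1/2\<bar> * of_bool (f x \<noteq> plug_in \<eta> x))"
    by (intro Bochner_Integration.integral_cong refl) (auto simp: plug_in_def)
  finally show ?thesis .
qed

text \<open>
  The margin and smoothness conditions hold for some version of the regression function only;
  the Bayes risk does not depend on the version.
\<close>

lemma bayes_risk_unique:
  assumes P: "joint_distribution d P" and "regression_function d P \<eta>" "regression_function d P \<eta>'"
  shows "risk P (plug_in \<eta>) = risk P (plug_in \<eta>')"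
proof -
  \<comment> \<open>The excess risk formula for the version \<open>\<eta>1\<close> has a nonnegative
    integrand, so \<open>plug_in \<eta>2\<close> cannot do better; exchanging the versions gives
    equality.\<close>
  have "risk P (plug_in \<eta>1) \<le> risk P (plug_in \<eta>2)"
    if "regression_function d P \<eta>1" "regression_function d P \<eta>2" for \<eta>1 \<eta>2
  proof -
    have "Measurable.pred (leb_Rd d) (plug_in \<eta>2)"
      using that(2) by (intro pred_plug_in) (simp add: regression_function_def)
    from excess_risk_eq[OF P that(1) this]
    have "risk P (plug_in \<eta>2) - risk P (plug_in \<eta>1) \<ge> 0"
      by (simp add: Bochner_Integration.integral_nonneg)
    then show ?thesis by simp
  qed
  with assms(2,3) show ?thesis by (meson order_antisym)
qed

lemma expected_excess_risk_eq:
  fixes g :: "'a \<Rightarrow> (nat \<Rightarrow> real) \<Rightarrow> real"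
  assumes P: "joint_distribution d P" and \<eta>: "regression_function d P \<eta>" and S: "prob_space S"
    and g: "(\<lambda>(\<omega>, x). g \<omega> x) \<in> borel_measurable (S \<Otimes>\<^sub>M leb_Rd d)"
  shows "(LINT \<omega>|S. risk P (plug_in (g \<omega>))) - risk P (plug_in \<eta>) =
    (LINT x|marginal d P. 2 * \<bar>\<eta> x - 1/2\<bar> * (LINT \<omega>|S. of_bool (plug_in (g \<omega>) x \<noteq> plug_in \<eta> x)))"
proof -
  let ?M = "marginal d P"
  interpret S: prob_space S by fact
  interpret M: prob_space ?M using P by (rule prob_space_marginal)
  interpret pair_prob_space S ?M ..
  note [measurable] = regression_function_measurable[OF \<eta>]
  have [measurable]: "(\<lambda>(\<omega>, x). g \<omega> x) \<in> borel_measurable (S \<Otimes>\<^sub>M ?M)"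
    using g by (simp add: measurable_cong_sets[OF sets_pair_measure_cong[OF refl sets_marginal] refl])
  define \<phi> where "\<phi> \<omega> x = 2 * \<bar>\<eta> x - 1/2\<bar> * of_bool (plug_in (g \<omega>) x \<noteq> plug_in \<eta> x)" for \<omega> x
  have \<eta>01: "\<And>x. x \<in> Rd d \<Longrightarrow> 0 \<le> \<eta> x \<and> \<eta> x \<le> 1"
    using \<eta> by (auto simp: regression_function_def)
  have \<phi>_meas [measurable]: "case_prod \<phi> \<in> borel_measurable (S \<Otimes>\<^sub>M ?M)"
    unfolding \<phi>_def plug_in_def case_prod_beta by measurable
  have \<phi>_bound: "\<bar>\<phi> \<omega> x\<bar> \<le> 1" if "x \<in> Rd d" for \<omega> x
  proof -
    have "2 * \<bar>\<eta> x - 1/2\<bar> \<le> 1" using \<eta>01[OF that] by (auto simp: abs_if)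
    then show ?thesis by (auto simp: \<phi>_def)
  qed
  have int: "integrable (S \<Otimes>\<^sub>M ?M) (case_prod \<phi>)"
    using \<phi>_bound by (intro integrable_const_bound[of _ 1]) (auto simp: space_pair_measure space_marginal)
  \<comment> \<open>Writing the risk as the constant Bayes risk plus an integral makes its
    integrability over \<open>S\<close> a consequence of that of \<open>\<phi>\<close>.\<close>
  have "(LINT \<omega>|S. risk P (plug_in (g \<omega>))) = (LINT \<omega>|S. risk P (plug_in \<eta>) + (LINT x|?M. \<phi> \<omega> x))"
  proof (intro Bochner_Integration.integral_cong refl)
    fix \<omega> assume "\<omega> \<in> space S"
    then have "g \<omega> \<in> borel_measurable (leb_Rd d)"
      using measurable_compose[OF measurable_Pair1' g, of \<omega>] by simp
    from excess_risk_eq[OF P \<eta> pred_plug_in[OF this]]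
    show "risk P (plug_in (g \<omega>)) = risk P (plug_in \<eta>) + (LINT x|?M. \<phi> \<omega> x)"
      by (simp add: \<phi>_def)
  qed
  also have "\<dots> = risk P (plug_in \<eta>) + (LINT \<omega>|S. LINT x|?M. \<phi> \<omega> x)"
    using integrable_fst[OF int] by (simp add: S.prob_space)
  also have "(LINT \<omega>|S. LINT x|?M. \<phi> \<omega> x) = (LINT x|?M. LINT \<omega>|S. \<phi> \<omega> x)"
    using Fubini_integral[OF int] by simp
  finally show ?thesis
    by (simp add: \<phi>_def)
qed

subsection \<open>The margin assumption\<close>

text \<open>One more power of \<open>2 ^ j\<close> is still beaten by the Gaussian factor, so the
  terms are eventually below the geometric sequence \<open>(1/2) ^ j\<close>.\<close>

lemma summable_dyadic_gaussian:
  fixes \<alpha> c :: real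
  assumes "c > 0"
  shows "summable (\<lambda>j. (2 ^ j) powr (1 + \<alpha>) * exp (- c * 4 ^ j))"
proof -
  have "((\<lambda>x::real. x powr (2 + \<alpha>) * exp (- c * x\<^sup>2)) \<longlongrightarrow> 0) at_top"
    using assms by real_asymp
  moreover have "filterlim (\<lambda>j::nat. 2 ^ j :: real) at_top sequentially"
    by real_asymp
  ultimately have "(\<lambda>j::nat. (2 ^ j) powr (2 + \<alpha>) * exp (- c * (2 ^ j)\<^sup>2)) \<longlonglongrightarrow> 0"
    by (rule filterlim_compose)
  then have "eventually (\<lambda>j::nat. (2 ^ j) powr (2 + \<alpha>) * exp (- c * (2 ^ j)\<^sup>2) < 1) sequentially"
    by (rule order_tendstoD) simp
  then have "eventually (\<lambda>j::nat. norm ((2 ^ j) powr (1 + \<alpha>) * exp (- c * 4 ^ j)) \<le> (1/2) ^ j) sequentially"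
  proof eventually_elim
    case (elim j)
    have "(2 ^ j) powr (2 + \<alpha>) = (2::real) ^ j * (2 ^ j) powr (1 + \<alpha>)"
      by (simp add: powr_add[of _ 1 "1 + \<alpha>", simplified] add.assoc[symmetric])
    moreover have "((2::real) ^ j)\<^sup>2 = 4 ^ j"
      by (simp add: power_mult[symmetric] power2_eq_square power_mult_distrib[symmetric])
    ultimately have "2 ^ j * ((2 ^ j) powr (1 + \<alpha>) * exp (- c * 4 ^ j)) \<le> 1"
      using elim by (simp add: mult.assoc)
    then show ?case by (simp add: power_one_over field_simps)
  qed
  then show ?thesis
    by (rule summable_comparison_test_ev) (simp add: summable_geometric)
qed

text \<open>
  The factor \<open>exp (C2 / 4) + C1\<close> covers both the trivial bound \<open>p \<le> 1\<close> on the innermost slice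
  and the tail bound on the others: on the slice \<open>2 ^ (j - 1) * \<delta> < \<gamma> \<le> 2 ^ j * \<delta>\<close> the tail bound
  is available at the inner radius only, which turns \<open>C2\<close> into \<open>C2 / 4\<close>.
\<close>

definition margin_constant :: "real \<Rightarrow> real \<Rightarrow> real \<Rightarrow> real \<Rightarrow> real" where
  "margin_constant \<alpha> C0 C1 C2 =
     2 * C0 * (exp (C2 / 4) + C1) * (\<Sum>j. (2 ^ j) powr (1 + \<alpha>) * exp (- (C2 / 4) * 4 ^ j))"

lemma margin_constant_pos:
  assumes "C0 > 0" "C1 > 0" "C2 > 0"
  shows "margin_constant \<alpha> C0 C1 C2 > 0"
proof -
  have "(\<Sum>j. (2 ^ j) powr (1 + \<alpha>) * exp (- (C2 / 4) * 4 ^ j) :: real) > 0"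
    using assms(3) by (intro suminf_pos summable_dyadic_gaussian) auto
  with assms show ?thesis
    unfolding margin_constant_def by (intro mult_pos_pos add_pos_pos) auto
qed

text \<open>The slicing argument, with \<open>\<gamma>\<close> for the distance of the regression
  function from 1/2 and \<open>p\<close> for the probability of disagreement. The bound
  \<open>B\<close> leaves finitely many slices and disappears when the finite sum is enlarged to the
  series.\<close>

lemma margin_integral_bound:
  fixes \<gamma> p :: "'a \<Rightarrow> real"
  assumes M: "prob_space M" and \<delta>: "\<delta> > 0" and C0: "C0 > 0" and C1: "C1 > 0" and C2: "C2 > 0"
    and \<gamma> [measurable]: "\<gamma> \<in> borel_measurable M" and p [measurable]: "p \<in> borel_measurable M"
    and \<gamma>_bound: "\<And>x. x \<in> space M \<Longrightarrow> 0 \<le> \<gamma> x \<and> \<gamma> x \<le> B"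
    and p01: "\<And>x. x \<in> space M \<Longrightarrow> 0 \<le> p x \<and> p x \<le> 1"
    and margin: "\<And>t. t > 0 \<Longrightarrow> measure M {x \<in> space M. 0 < \<gamma> x \<and> \<gamma> x \<le> t} \<le> C0 * t powr \<alpha>"
    and tail: "AE x in M. \<forall>j::nat. 2 ^ j * \<delta> \<le> \<gamma> x \<longrightarrow> p x \<le> C1 * exp (- C2 * 4 ^ j)"
  shows "(LINT x|M. 2 * \<gamma> x * p x) \<le> margin_constant \<alpha> C0 C1 C2 * \<delta> powr (1 + \<alpha>)"
proof -
  interpret prob_space M by fact
  \<comment> \<open>These are whole sublevel sets and not annuli: the margin condition bounds them
    directly, and the extra terms in the upper bound are nonnegative.\<close>
  define S where "S j = {x \<in> space M. 0 < \<gamma> x \<and> \<gamma> x \<le> 2 ^ j * \<delta>}" for j :: nat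
  define q where "q j = (exp (C2 / 4) + C1) * exp (- (C2 / 4) * 4 ^ j)" for j :: nat
  define c where "c j = 2 * (2 ^ j * \<delta>) * q j" for j :: nat
  have S [measurable]: "S j \<in> sets M" for j unfolding S_def by measurable
  have q_pos: "q j > 0" for j
    unfolding q_def using C1 by (intro mult_pos_pos add_pos_pos) auto
  have c_nonneg: "c j \<ge> 0" for j
    unfolding c_def using \<delta> less_imp_le[OF q_pos[of j]] by simp
  obtain J :: nat where J: "B / \<delta> < 2 ^ J"
    using real_arch_pow[of 2 "B / \<delta>"] by auto
  then have J: "B \<le> 2 ^ J * \<delta>" using \<delta> by (simp add: field_simps)
  have pointwise: "AE x in M. 2 * \<gamma> x * p x \<le> (\<Sum>j\<le>J. c j * indicator (S j) x)"
    using tail AE_space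
  proof eventually_elim
    case (elim x)
    then have tail: "\<forall>j::nat. 2 ^ j * \<delta> \<le> \<gamma> x \<longrightarrow> p x \<le> C1 * exp (- C2 * 4 ^ j)" and x: "x \<in> space M"
      by auto
    show "2 * \<gamma> x * p x \<le> (\<Sum>j\<le>J. c j * indicator (S j) x)"
    proof (cases "\<gamma> x = 0")
      \<comment> \<open>The margin condition does not control points with
        \<open>\<gamma> x = 0\<close>, but the left-hand side vanishes there.\<close>
      case True
      then show ?thesis using c_nonneg by (simp add: sum_nonneg)
    next
      case False
      with \<gamma>_bound[OF x] have pos: "\<gamma> x > 0" by auto
      \<comment> \<open>The least such index finds the slice of \<open>x\<close>; when it is
        positive, minimality gives the lower bound on \<open>\<gamma> x\<close> that makes the tail
        bound available at \<open>j - 1\<close>.\<close>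
      define j where "j = (LEAST j. \<gamma> x \<le> 2 ^ j * \<delta>)"
      have xJ: "\<gamma> x \<le> 2 ^ J * \<delta>" using \<gamma>_bound[OF x] J by linarith
      have j: "\<gamma> x \<le> 2 ^ j * \<delta>" "j \<le> J"
        unfolding j_def using xJ by (rule LeastI, rule Least_le)
      have "p x \<le> q j"
      proof (cases j)
        case 0
        have "1 \<le> q 0"
          using C1 by (simp add: q_def algebra_simps exp_minus field_simps)
        with p01[OF x] 0 show ?thesis by simp
      next
        case (Suc i)
        then have "\<not> \<gamma> x \<le> 2 ^ i * \<delta>"
          unfolding j_def by (intro not_less_Least) simp
        with tail have "p x \<le> C1 * exp (- C2 * 4 ^ i)" by simp
        \<comment> \<open>Here \<open>C2 * 4 ^ i = (C2 / 4) * 4 ^ j\<close>, because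
          \<open>j = Suc i\<close>.\<close>
        also have "\<dots> \<le> q j"
          unfolding q_def Suc by (simp add: mult_right_mono)
        finally show ?thesis .
      qed
      then have "2 * \<gamma> x * p x \<le> c j"
        unfolding c_def using j(1) pos p01[OF x] \<delta> by (intro mult_mono) auto
      also have "\<dots> = c j * indicator (S j) x"
        using x pos j(1) by (simp add: S_def)
      also have "\<dots> \<le> (\<Sum>j\<le>J. c j * indicator (S j) x)"
        using j(2) c_nonneg by (intro member_le_sum) auto
      finally show ?thesis .
    qed
  qed
  have "(LINT x|M. 2 * \<gamma> x * p x) \<le> (LINT x|M. (\<Sum>j\<le>J. c j * indicator (S j) x))"
  proof (rule integral_mono_AE[OF _ _ pointwise])
    show "integrable M (\<lambda>x. 2 * \<gamma> x * p x)"
    proof (rule integrable_const_bound[of _ "2 * B"])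
      have "\<gamma> x * p x \<le> B * 1" if "x \<in> space M" for x
        using \<gamma>_bound[OF that] p01[OF that] by (intro mult_mono) auto
      then show "AE x in M. norm (2 * \<gamma> x * p x) \<le> 2 * B"
        using \<gamma>_bound p01 by (intro AE_I2) (simp add: abs_mult mult.assoc)
    qed measurable
    show "integrable M (\<lambda>x. \<Sum>j\<le>J. c j * indicator (S j) x)"
      by (intro Bochner_Integration.integrable_sum integrable_mult_right integrable_real_indicator S)
         (simp add: emeasure_eq_measure)
  qed
  also have "\<dots> = (\<Sum>j\<le>J. LINT x|M. c j * indicator (S j) x)"
    by (intro Bochner_Integration.integral_sum integrable_mult_right integrable_real_indicator S)
       (simp add: emeasure_eq_measure)
  also have "\<dots> = (\<Sum>j\<le>J. c j * measure M (S j))"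
    by simp
  also have "\<dots> \<le> (\<Sum>j\<le>J. c j * (C0 * (2 ^ j * \<delta>) powr \<alpha>))"
    using margin \<delta> c_nonneg unfolding S_def by (intro sum_mono mult_left_mono) auto
  also have "\<dots> = 2 * C0 * (exp (C2 / 4) + C1) *
      (\<Sum>j\<le>J. (2 ^ j) powr (1 + \<alpha>) * exp (- (C2 / 4) * 4 ^ j)) * \<delta> powr (1 + \<alpha>)"
    unfolding sum_distrib_left sum_distrib_right
    using \<delta> by (intro sum.cong refl) (simp add: c_def q_def powr_mult powr_add mult_ac)
  also have "\<dots> \<le> margin_constant \<alpha> C0 C1 C2 * \<delta> powr (1 + \<alpha>)"
    unfolding margin_constant_def using C0 C1 C2
    by (intro mult_right_mono mult_left_mono sum_le_suminf summable_dyadic_gaussian) auto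
  finally show ?thesis .
qed

text \<open>Disagreement means that the threshold 1/2 lies between \<open>f x\<close> and
  \<open>g x\<close>.\<close>

lemma plug_in_neq_imp_dist:
  assumes "plug_in f x \<noteq> plug_in g x"
  shows "\<bar>g x - 1/2\<bar> \<le> \<bar>f x - g x\<bar>"
  using assms unfolding plug_in_def by (auto simp: abs_if)

text \<open>This isolates what is used of the estimator: joint measurability and a Gaussian tail at
  scale \<open>a\<close>, which later becomes a power of the sample size.\<close>

lemma expected_excess_risk_le:
  assumes P: "joint_distribution d P" and \<eta>: "regression_function d P \<eta>"
    and margin: "margin_assumption d \<alpha> C0 P \<eta>" and S: "prob_space S"
    and g: "(\<lambda>(\<omega>, x). g \<omega> x) \<in> borel_measurable (S \<Otimes>\<^sub>M leb_Rd d)"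
    and C: "C0 > 0" "C1 > 0" "C2 > 0" and a: "a > 0"
    and tail: "\<And>\<delta>. \<delta> > 0 \<Longrightarrow> AE x in marginal d P.
      measure S {\<omega> \<in> space S. \<bar>g \<omega> x - \<eta> x\<bar> \<ge> \<delta>} \<le> C1 * exp (- C2 * a * \<delta>\<^sup>2)"
  shows "(LINT \<omega>|S. risk P (plug_in (g \<omega>))) - risk P (plug_in \<eta>)
    \<le> margin_constant \<alpha> C0 C1 C2 * a powr (- (1 + \<alpha>) / 2)"
proof -
  let ?M = "marginal d P"
  interpret S: prob_space S by fact
  interpret M: prob_space ?M using P by (rule prob_space_marginal)
  have \<eta>01: "\<And>x. x \<in> Rd d \<Longrightarrow> 0 \<le> \<eta> x \<and> \<eta> x \<le> 1"
    using \<eta> by (auto simp: regression_function_def)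
  note \<eta>_meas [measurable] = regression_function_measurable[OF \<eta>]
  have g' [measurable]: "(\<lambda>(\<omega>, x). g \<omega> x) \<in> borel_measurable (S \<Otimes>\<^sub>M ?M)"
    using g by (simp add: measurable_cong_sets[OF sets_pair_measure_cong[OF refl sets_marginal] refl])
  \<comment> \<open>\<open>p\<close> integrates over \<open>S\<close> with \<open>x\<close> as
    parameter, so its measurability uses the product in the swapped order.\<close>
  have g'' [measurable]: "(\<lambda>z. g (snd z) (fst z)) \<in> borel_measurable (?M \<Otimes>\<^sub>M S)"
    using measurable_compose[OF measurable_pair_swap' g'] by (simp add: case_prod_beta)
  define p where "p x = (LINT \<omega>|S. of_bool (plug_in (g \<omega>) x \<noteq> plug_in \<eta> x) :: real)" for x
  \<comment> \<open>Chosen so that \<open>a * \<delta>\<^sup>2 = 1\<close>: at radius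
    \<open>2 ^ j * \<delta>\<close> the tail bound becomes
    \<open>C1 * exp (- C2 * 4 ^ j)\<close>.\<close>
  define \<delta> where "\<delta> = a powr (- 1 / 2)"
  have \<delta>: "\<delta> > 0" using a by (simp add: \<delta>_def)
  have a\<delta>: "a * \<delta>\<^sup>2 = 1"
  proof -
    have "\<delta>\<^sup>2 = a powr (- 1)"
      unfolding \<delta>_def power2_eq_square by (simp add: powr_add[symmetric])
    with a show ?thesis by (simp add: powr_minus)
  qed
  have section_meas: "(\<lambda>\<omega>. g \<omega> x) \<in> borel_measurable S" if "x \<in> Rd d" for x
    using measurable_compose[OF measurable_Pair2' g', of x] that by (simp add: space_marginal)
  have p_eq: "p x = measure S {\<omega> \<in> space S. plug_in (g \<omega>) x \<noteq> plug_in \<eta> x}" if "x \<in> Rd d" for x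
  proof -
    note [measurable] = section_meas[OF that]
    have "p x = (LINT \<omega>|S. indicator {\<omega> \<in> space S. plug_in (g \<omega>) x \<noteq> plug_in \<eta> x} \<omega>)"
      unfolding p_def by (intro Bochner_Integration.integral_cong) auto
    also have "\<dots> = measure S ({\<omega> \<in> space S. plug_in (g \<omega>) x \<noteq> plug_in \<eta> x} \<inter> space S)"
      by (rule Bochner_Integration.integral_indicator)
    finally show ?thesis by (simp add: Int_def conj_commute)
  qed
  have "(LINT \<omega>|S. risk P (plug_in (g \<omega>))) - risk P (plug_in \<eta>) = (LINT x|?M. 2 * \<bar>\<eta> x - 1/2\<bar> * p x)"
    unfolding p_def by (rule expected_excess_risk_eq[OF P \<eta> S g])
  also have "\<dots> \<le> margin_constant \<alpha> C0 C1 C2 * \<delta> powr (1 + \<alpha>)"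
  proof (rule margin_integral_bound[OF M.prob_space_axioms \<delta> C, where B = 1])
    show "(\<lambda>x. \<bar>\<eta> x - 1/2\<bar>) \<in> borel_measurable ?M" by measurable
    show "p \<in> borel_measurable ?M"
      unfolding p_def plug_in_def by measurable
    show "0 \<le> \<bar>\<eta> x - 1/2\<bar> \<and> \<bar>\<eta> x - 1/2\<bar> \<le> 1" if "x \<in> space ?M" for x
      using \<eta>01[of x] that by (auto simp: abs_if space_marginal)
    show "0 \<le> p x \<and> p x \<le> 1" if "x \<in> space ?M" for x
      using that by (simp add: p_eq space_marginal)
    show "measure ?M {x \<in> space ?M. 0 < \<bar>\<eta> x - 1/2\<bar> \<and> \<bar>\<eta> x - 1/2\<bar> \<le> t} \<le> C0 * t powr \<alpha>" if "t > 0" for t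
      using margin that by (simp add: margin_assumption_def space_marginal)
    have "AE x in ?M. \<forall>j::nat. measure S {\<omega> \<in> space S. \<bar>g \<omega> x - \<eta> x\<bar> \<ge> 2 ^ j * \<delta>}
        \<le> C1 * exp (- C2 * a * (2 ^ j * \<delta>)\<^sup>2)"
      unfolding AE_all_countable using tail \<delta> by simp
    then show "AE x in ?M. \<forall>j::nat. 2 ^ j * \<delta> \<le> \<bar>\<eta> x - 1/2\<bar> \<longrightarrow> p x \<le> C1 * exp (- C2 * 4 ^ j)"
      using AE_space
    proof (eventually_elim, intro allI impI)
      fix x j
      assume tail: "\<forall>j::nat. measure S {\<omega> \<in> space S. \<bar>g \<omega> x - \<eta> x\<bar> \<ge> 2 ^ j * \<delta>}
          \<le> C1 * exp (- C2 * a * (2 ^ j * \<delta>)\<^sup>2)"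
        and x: "x \<in> space ?M" and j: "2 ^ j * \<delta> \<le> \<bar>\<eta> x - 1/2\<bar>"
      have x: "x \<in> Rd d" using x by (simp add: space_marginal)
      note [measurable] = section_meas[OF x]
      have "p x \<le> measure S {\<omega> \<in> space S. \<bar>g \<omega> x - \<eta> x\<bar> \<ge> 2 ^ j * \<delta>}"
        unfolding p_eq[OF x]
      proof (rule S.finite_measure_mono)
        show "{\<omega> \<in> space S. plug_in (g \<omega>) x \<noteq> plug_in \<eta> x}
            \<subseteq> {\<omega> \<in> space S. \<bar>g \<omega> x - \<eta> x\<bar> \<ge> 2 ^ j * \<delta>}"
          using plug_in_neq_imp_dist[of "g _" x \<eta>] j by (auto intro: order_trans)
      qed measurable
      also have "\<dots> \<le> C1 * exp (- C2 * a * (2 ^ j * \<delta>)\<^sup>2)"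
        using tail by blast
      also have "- C2 * a * (2 ^ j * \<delta>)\<^sup>2 = - C2 * 4 ^ j * (a * \<delta>\<^sup>2)"
      proof -
        have "((2::real) ^ j)\<^sup>2 = 4 ^ j"
          by (simp add: power2_eq_square power_mult_distrib[symmetric])
        then show ?thesis by (simp add: power_mult_distrib mult_ac)
      qed
      finally show "p x \<le> C1 * exp (- C2 * 4 ^ j)"
        by (simp add: a\<delta>)
    qed
  qed
  also have "\<delta> powr (1 + \<alpha>) = a powr (- (1 + \<alpha>) / 2)"
    unfolding \<delta>_def powr_powr by (rule arg_cong) (simp add: field_simps)
  finally show ?thesis .
qed

subsection \<open>The rate of the plug-in classifier\<close>

text \<open>The existential precedes the quantifiers over the dimension, the smoothness, the density
  bounds and the kernel; this encodes that the constant depends on \<alpha>, \<open>C0\<close>,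
  \<open>C1\<close> and \<open>C2\<close> alone. A supremum in the extended reals needs no side
  condition on boundedness or nonemptiness.\<close>

theorem theorem3p3:
  fixes \<alpha> C0 C1 C2 :: real
  assumes "\<alpha> \<ge> 0" and "C0 > 0" and "C1 > 0" and "C2 > 0"
  shows "\<exists>C>0. \<forall>(d::nat) (c0::real) (r0::real) (\<beta>::real) (L::real) (\<mu>min::real) (\<mu>max::real)
           (\<C> :: (nat \<Rightarrow> real) set) (K :: (nat \<Rightarrow> real) \<Rightarrow> real).
    d \<ge> 1 \<longrightarrow> c0 > 0 \<longrightarrow> r0 > 0 \<longrightarrow> \<beta> > 0 \<longrightarrow> L > 0 \<longrightarrow> \<mu>min > 0 \<longrightarrow> \<mu>max > \<mu>min \<longrightarrow>
    compact \<C> \<longrightarrow> \<C> \<subseteq> Rd d \<longrightarrow> kernel_conditions d \<beta> K \<longrightarrow>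
    (\<forall>n\<ge>1. \<forall>\<delta>>0. \<forall>P\<in>P_Sigma d \<alpha> C0 \<beta> L c0 r0 \<mu>min \<mu>max \<C>. \<forall>\<eta>. regression_function d P \<eta> \<longrightarrow>
       (AE x in marginal d P.
          measure (sample_law n P)
            {\<omega> \<in> space (sample_law n P). \<bar>eta_star d \<beta> n (bandwidth d \<beta> n) K \<omega> x - \<eta> x\<bar> \<ge> \<delta>}
          \<le> C1 * exp (- C2 * real n powr (2 * \<beta> / (2 * \<beta> + real d)) * \<delta>\<^sup>2))) \<longrightarrow>
    (\<forall>n\<ge>1.
       (SUP (P, \<eta>) \<in> (SIGMA P : P_Sigma d \<alpha> C0 \<beta> L c0 r0 \<mu>min \<mu>max \<C>. {\<eta>. regression_function d P \<eta>}).
          ereal ((LINT \<omega>|sample_law n P. risk P (plug_in (eta_star d \<beta> n (bandwidth d \<beta> n) K \<omega>)))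
                 - risk P (plug_in \<eta>)))
       \<le> ereal (C * real n powr (- (\<beta> * (1 + \<alpha>) / (2 * \<beta> + real d)))))"
proof (intro exI[of _ "margin_constant \<alpha> C0 C1 C2"] conjI allI impI)
  show "margin_constant \<alpha> C0 C1 C2 > 0"
    using assms by (intro margin_constant_pos)
next
  fix d n :: nat and c0 r0 \<beta> L \<mu>min \<mu>max :: real and \<C> :: "(nat \<Rightarrow> real) set" and K :: "(nat \<Rightarrow> real) \<Rightarrow> real"
  assume \<beta>: "\<beta> > 0" and n: "n \<ge> 1" and K: "kernel_conditions d \<beta> K"
    and conc: "\<forall>n\<ge>1. \<forall>\<delta>>0. \<forall>P\<in>P_Sigma d \<alpha> C0 \<beta> L c0 r0 \<mu>min \<mu>max \<C>. \<forall>\<eta>. regression_function d P \<eta> \<longrightarrow>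
       (AE x in marginal d P.
          measure (sample_law n P)
            {\<omega> \<in> space (sample_law n P). \<bar>eta_star d \<beta> n (bandwidth d \<beta> n) K \<omega> x - \<eta> x\<bar> \<ge> \<delta>}
          \<le> C1 * exp (- C2 * real n powr (2 * \<beta> / (2 * \<beta> + real d)) * \<delta>\<^sup>2))"
  let ?\<P> = "P_Sigma d \<alpha> C0 \<beta> L c0 r0 \<mu>min \<mu>max \<C>"
  let ?g = "eta_star d \<beta> n (bandwidth d \<beta> n) K"
  let ?a = "real n powr (2 * \<beta> / (2 * \<beta> + real d))"
  have bound: "(LINT \<omega>|sample_law n P. risk P (plug_in (?g \<omega>))) - risk P (plug_in \<eta>)
      \<le> margin_constant \<alpha> C0 C1 C2 * real n powr (- (\<beta> * (1 + \<alpha>) / (2 * \<beta> + real d)))"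
    if P_in: "P \<in> ?\<P>" and \<eta>: "regression_function d P \<eta>" for P \<eta>
  proof -
    \<comment> \<open>The margin condition is known for some version \<open>\<eta>'\<close> only,
      while the concentration hypothesis covers every version. The rate is therefore proved for
      \<open>\<eta>'\<close> and transferred by \<open>bayes_risk_unique\<close>.\<close>
    obtain \<eta>' where P: "joint_distribution d P" and \<eta>': "regression_function d P \<eta>'"
      and margin: "margin_assumption d \<alpha> C0 P \<eta>'"
      using P_in by (auto simp: P_Sigma_def)
    have "prob_space P" and sets_P: "sets P = sets (leb_Rd d \<Otimes>\<^sub>M count_space UNIV)"
      using P by (auto simp: joint_distribution_def)
    then have S: "prob_space (sample_law n P)"
      unfolding sample_law_def by (intro prob_space_PiM)
    have "(\<lambda>(\<omega>, x). ?g \<omega> x) \<in> borel_measurable (sample_law n P \<Otimes>\<^sub>M leb_Rd d)"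
      using K n by (intro borel_measurable_eta_star[OF sets_P]) (auto simp: kernel_conditions_def bandwidth_def)
    from expected_excess_risk_le[OF P \<eta>' margin S this assms(2-4), of ?a]
    have "(LINT \<omega>|sample_law n P. risk P (plug_in (?g \<omega>))) - risk P (plug_in \<eta>')
        \<le> margin_constant \<alpha> C0 C1 C2 * ?a powr (- (1 + \<alpha>) / 2)"
      using conc n P_in \<eta>' by simp
    also have "?a powr (- (1 + \<alpha>) / 2) = real n powr (- (\<beta> * (1 + \<alpha>) / (2 * \<beta> + real d)))"
    proof -
      define D where "D = 2 * \<beta> + real d"
      have "D > 0" using \<beta> by (simp add: D_def add_pos_nonneg)
      then have "2 * \<beta> / D * (- (1 + \<alpha>) / 2) = - (\<beta> * (1 + \<alpha>) / D)"
        by (simp add: field_simps)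
      then show ?thesis
        unfolding powr_powr D_def by (rule arg_cong)
    qed
    finally show ?thesis
      unfolding bayes_risk_unique[OF P \<eta> \<eta>'] .
  qed
  show "(SUP (P, \<eta>) \<in> (SIGMA P : ?\<P>. {\<eta>. regression_function d P \<eta>}).
          ereal ((LINT \<omega>|sample_law n P. risk P (plug_in (?g \<omega>))) - risk P (plug_in \<eta>)))
       \<le> ereal (margin_constant \<alpha> C0 C1 C2 * real n powr (- (\<beta> * (1 + \<alpha>) / (2 * \<beta> + real d))))"
    by (rule SUP_least) (auto intro: bound)
qed

end
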